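(* Let $(G,\sigma)$ be a signed graph of order $n$. Then $r(G,\sigma)+2\alpha(G)=2n-2c(G)$ if and only if all of the following hold: (i) the cycles (if any) of $G$ are pairwise vertex-disjoint; (ii) for each cycle $C_q$ (of length $q$) of $(G,\sigma)$, either $q\equiv 0 \pmod 4$ and $\sigma(C_q)=+$, or $q\equiv 2\pmod 4$ and $\sigma(C_q)=-$; (iii) $\alpha(T_G)=\alpha([T_G])+c(G)$.
   Context: All graphs are simple and finite. A signed graph $(G,\sigma)$ consists of a simple graph $G$ and a map $\sigma:E(G)\to\{+,-\}$; its adjacency matrix $A(G,\sigma)$ has $(i,j)$-entry $\sigma(v_iv_j)$ if $v_iv_j\in E(G)$ and $0$ otherwise, and $r(G,\sigma)$ is its rank. $\alpha(G)$ is the independence number of $G$ and $c(G)=|E(G)|-|V(G)|+\omega(G)$ the cyclomatic number ($\omega(G)$ = number of components). The sign of a cycle $C$ is $\sigma(C)=\prod_{e\in C}\sigma(e)$. For a graph $G$ whose cycles are pairwise vertex-disjoint, $T_G$ denotes the forest obtained from $G$ by contracting each cycle into a single vertex (called a cyclic vertex); $\mathscr{O}_G$ is the set of cyclic vertices, and $[T_G]=T_G-\mathscr{O}_G$ is the subgraph of $T_G$ induced by the non-cyclic vertices. *)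

theory Defs
  imports "HOL-Analysis.Analysis" "HOL-Library.Ramsey"
begin

record 'a graph =
  verts :: "'a set"
  edges :: "'a set set"

definition simple_graph :: "'a graph \<Rightarrow> bool" where
  "simple_graph G \<longleftrightarrow> finite (verts G) \<and> edges G \<subseteq> nsets (verts G) 2"

text \<open>Signs are the real numbers \<open>1\<close> and \<open>-1\<close>; the values of \<open>\<sigma>\<close> outside the edge set
  are irrelevant.\<close>

definition signed_graph :: "'a graph \<Rightarrow> ('a set \<Rightarrow> real) \<Rightarrow> bool" where
  "signed_graph G \<sigma> \<longleftrightarrow> simple_graph G \<and> \<sigma> \<in> edges G \<rightarrow> {1, -1}"

text \<open>Rows and columns are indexed by the type \<open>'v\<close>, so this is the adjacency matrix when
  \<open>verts G = UNIV\<close>.\<close>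

definition adj_matrix :: "'v::finite graph \<Rightarrow> ('v set \<Rightarrow> real) \<Rightarrow> real ^ 'v ^ 'v" where
  "adj_matrix G \<sigma> = (\<chi> i j. if {i, j} \<in> edges G then \<sigma> {i, j} else 0)"

definition independence_number :: "'a graph \<Rightarrow> nat" where
  "independence_number G = Max {card S | S. S \<subseteq> verts G \<and> indep S (edges G)}"

definition adj_rel :: "'a graph \<Rightarrow> ('a \<times> 'a) set" where
  "adj_rel G = {(u, v). {u, v} \<in> edges G}"

definition num_components :: "'a graph \<Rightarrow> nat" where
  "num_components G = card (verts G // (adj_rel G)\<^sup>*)"

definition cyclomatic_number :: "'a graph \<Rightarrow> int" where
  "cyclomatic_number G =
     int (card (edges G)) - int (card (verts G)) + int (num_components G)"

definition cycle_graph :: "'a list \<Rightarrow> 'a graph" where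
  "cycle_graph p = \<lparr>verts = set p, edges = {{p ! i, p ! (Suc i mod length p)} | i. i < length p}\<rparr>"

text \<open>Cycles are subgraphs, not vertex sequences: rotating or reversing a sequence does not
  change the cycle.\<close>

definition cycles :: "'a graph \<Rightarrow> 'a graph set" where
  "cycles G = {cycle_graph p | p. 3 \<le> length p \<and> distinct p \<and>
     verts (cycle_graph p) \<subseteq> verts G \<and> edges (cycle_graph p) \<subseteq> edges G}"

definition cycle_length :: "'a graph \<Rightarrow> nat" where
  "cycle_length C = card (edges C)"

definition cycle_sign :: "('a set \<Rightarrow> real) \<Rightarrow> 'a graph \<Rightarrow> real" where
  "cycle_sign \<sigma> C = (\<Prod>e\<in>edges C. \<sigma> e)"

definition cycles_vertex_disjoint :: "'a graph \<Rightarrow> bool" where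
  "cycles_vertex_disjoint G \<longleftrightarrow> pairwise (\<lambda>C D. disjnt (verts C) (verts D)) (cycles G)"

text \<open>The vertices of the contracted graph are the blocks that are identified: the vertex set of
  a cycle for a cyclic vertex, and the singleton \<open>{v}\<close> for a vertex \<open>v\<close> on no cycle. This is
  meant for graphs whose cycles are pairwise vertex-disjoint; then the blocks partition the vertex
  set, and the contraction produces neither loops nor parallel edges, because a chord of a
  cycle, or two edges of \<open>G\<close> between the same two blocks, would give two intersecting cycles.\<close>

definition cyclic_vertices :: "'a graph \<Rightarrow> 'a set set" where
  "cyclic_vertices G = verts ` cycles G"

definition contract_cycles :: "'a graph \<Rightarrow> 'a set graph" where
  "contract_cycles G =
     (let B = cyclic_vertices G \<union> {{v} | v. v \<in> verts G \<and> v \<notin> \<Union> (cyclic_vertices G)} in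
      \<lparr>verts = B,
       edges = {{X, Y} | X Y. X \<in> B \<and> Y \<in> B \<and> X \<noteq> Y \<and> (\<exists>x\<in>X. \<exists>y\<in>Y. {x, y} \<in> edges G)}\<rparr>)"

definition delete_verts :: "'a graph \<Rightarrow> 'a set \<Rightarrow> 'a graph" where
  "delete_verts G S = \<lparr>verts = verts G - S, edges = {e \<in> edges G. e \<subseteq> verts G - S}\<rparr>"

definition noncyclic_part :: "'a graph \<Rightarrow> 'a set graph" where
  "noncyclic_part G = delete_verts (contract_cycles G) (cyclic_vertices G)"

end

theory Submission
  imports Defs "HOL-Number_Theory.Cong" "HOL-Library.Transitive_Closure_Table"
begin

text \<open>Put \<open>f(G) = r(G) + 2\<alpha>(G) - 2n + 2c(G)\<close>. Deleting an isolated vertex, a pendant vertex with its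
  neighbour, or a vertex on a cycle never increases \<open>f\<close>, so \<open>f \<ge> 0\<close>, and if \<open>f(G) = 0\<close> then every one of
  these deletions is tight. Tightness at a vertex where one cycle branches off another is impossible because there
  \<open>c\<close> drops by at least two; this gives (i). Tight deletions also reduce \<open>G\<close> to any single one of its
  cycles, whose rank then determines its length and sign; this gives (ii). For (iii) one inducts:
  counting degrees produces a vertex of degree at most one off the cycles or a cycle with at most
  one outgoing edge, and deleting it is again tight.

  Conversely, (iii) provides an independent set \<open>S\<close> of \<open>[T\<^sub>G]\<close> of maximum size that is not adjacent
  to the cycles. Deleting the remaining acyclic vertices \<open>W\<close> leaves only isolated vertices and the cycles,
  so \<open>r(G) \<le> 2|W| + \<Sum> (q - 2)\<close>, while \<open>\<alpha>(G) \<le> |S| + \<Sum> q/2\<close>; together \<open>f(G) \<le> 0\<close>.\<close>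

section \<open>Cycles as periodic sequences\<close>

text \<open>That the deletions never increase the excess is arithmetic. For a vertex on a cycle,
  rank and independence number cannot grow, and the 2 gained from \<open>-2n\<close> is paid by the
  drop of \<open>c\<close> by at least one. For a pendant pair, the rank loses at least 2 and the
  independence number at least 1, which balances the two lost vertices. In both cases a larger loss
  of \<open>c\<close> remains as slack, and zero excess forces the slack to vanish; most structural
  conclusions come from this. Deleted vertices keep their rows and columns in the matrix, filled
  with zeros, so that every induction stays within one vertex type. The obstacle in (iii) is a cycle
  with one outgoing edge \<open>{x, y}\<close>: a set obtained from the smaller graph may contain
  \<open>y\<close>, which is adjacent to the cycle in \<open>G\<close>. The way out is to delete
  \<open>y\<close> as well and to show that this does not change the independence number. The
  inductions never touch the contracted forest. Its degrees appear as counts of edges outside the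
  cycles, and its independent sets as vertex sets of \<open>G\<close>.\<close>

text \<open>A cycle is handled as a sequence indexed by all naturals, periodic with period equal to its
  length; re-rooting it at another vertex is then a mere shift of the index.\<close>

definition closed_seq :: "nat \<Rightarrow> (nat \<Rightarrow> 'a) \<Rightarrow> bool" where
  "closed_seq q v \<longleftrightarrow> 3 \<le> q \<and> (\<forall>i j. v i = v j \<longleftrightarrow> i mod q = j mod q)"

definition seq_graph :: "(nat \<Rightarrow> 'a) \<Rightarrow> 'a graph" where
  "seq_graph v = \<lparr>verts = range v, edges = range (\<lambda>i. {v i, v (Suc i)})\<rparr>"

lemma verts_seq_graph [simp]: "verts (seq_graph v) = range v"
  and edges_seq_graph [simp]: "edges (seq_graph v) = range (\<lambda>i. {v i, v (Suc i)})"
  by (simp_all add: seq_graph_def)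

lemma range_mod:
  assumes "0 < (q::nat)" and "\<And>i. f i = f (i mod q)"
  shows "range f = f ` {..<q}"
proof
  show "range f \<subseteq> f ` {..<q}"
  proof
    fix y assume "y \<in> range f"
    then obtain i where "y = f i" by auto
    then have "y = f (i mod q)" using assms(2) by metis
    then show "y \<in> f ` {..<q}" using assms(1) by auto
  qed
qed auto

lemma closed_seq_mod: "closed_seq q v \<Longrightarrow> v (i mod q) = v i"
  unfolding closed_seq_def by simp

lemma closed_seq_Suc_mod: "closed_seq q v \<Longrightarrow> v (Suc (i mod q)) = v (Suc i)"
  unfolding closed_seq_def by (simp add: mod_Suc_eq)

lemma closed_seq_edge_mod:
  "closed_seq q v \<Longrightarrow> {v i, v (Suc i)} = {v (i mod q), v (Suc (i mod q))}"
  using closed_seq_mod[of q v i] closed_seq_Suc_mod[of q v i] by simp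

lemma closed_seq_range: "closed_seq q v \<Longrightarrow> range v = v ` {..<q}"
  by (rule range_mod) (auto simp: closed_seq_def)

lemma closed_seq_edges:
  assumes "closed_seq q v"
  shows "edges (seq_graph v) = (\<lambda>i. {v i, v (Suc i)}) ` {..<q}"
  unfolding edges_seq_graph
proof (rule range_mod)
  show "0 < q" using assms by (simp add: closed_seq_def)
  show "{v i, v (Suc i)} = {v (i mod q), v (Suc (i mod q))}" for i
    by (rule closed_seq_edge_mod[OF assms])
qed

lemma closed_seq_shift:
  assumes "closed_seq q v"
  shows "closed_seq q (\<lambda>i. v (i + k))" "seq_graph (\<lambda>i. v (i + k)) = seq_graph v"
proof -
  have q: "3 \<le> q" and v: "\<And>i j. v i = v j \<longleftrightarrow> i mod q = j mod q"
    using assms by (auto simp: closed_seq_def)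
  have inj: "(i + k) mod q = (j + k) mod q \<longleftrightarrow> i mod q = j mod q" for i j
    using cong_add_rcancel_nat[of i k j q] by (simp add: cong_def)
  show "closed_seq q (\<lambda>i. v (i + k))"
    using q v inj by (simp add: closed_seq_def)
  \<comment> \<open>Natural numbers do not allow a shift by \<open>-k\<close>;
    \<open>q * k - k\<close> represents it modulo \<open>q\<close>.\<close>
  have wrap: "v i = v (i + (q * k - k) + k)" "v (Suc i) = v (Suc (i + (q * k - k) + k))" for i
  proof -
    have "k \<le> q * k" using q by simp
    then have "i + (q * k - k) + k = i + q * k" "Suc (i + (q * k - k) + k) = Suc i + q * k"
      by linarith+
    then show "v i = v (i + (q * k - k) + k)" "v (Suc i) = v (Suc (i + (q * k - k) + k))"
      by (simp_all only: v mod_mult_self2)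
  qed
  have "range (\<lambda>i. v (i + k)) = range v"
    using wrap by blast
  moreover have "range (\<lambda>i. {v (i + k), v (Suc i + k)}) = range (\<lambda>i. {v i, v (Suc i)})"
  proof (intro equalityI subsetI)
    fix e assume "e \<in> range (\<lambda>i. {v i, v (Suc i)})"
    then obtain i where "e = {v i, v (Suc i)}" by auto
    then have "e = {v (i + (q * k - k) + k), v (Suc (i + (q * k - k)) + k)}" using wrap[of i] by simp
    then show "e \<in> range (\<lambda>i. {v (i + k), v (Suc i + k)})" by blast
  qed auto
  ultimately show "seq_graph (\<lambda>i. v (i + k)) = seq_graph v"
    by (simp add: seq_graph_def)
qed

text \<open>A period of at least three excludes that two edges agree with their ends swapped: this
  would give 2 = 0 modulo \<open>q\<close>.\<close>

lemma closed_seq_edge_eq_iff: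
  assumes "closed_seq q v"
  shows "{v i, v (Suc i)} = {v j, v (Suc j)} \<longleftrightarrow> i mod q = j mod q"
proof -
  have q: "3 \<le> q" and v: "\<And>i j. v i = v j \<longleftrightarrow> i mod q = j mod q"
    using assms by (auto simp: closed_seq_def)
  have False if "i mod q = Suc j mod q" "Suc i mod q = j mod q"
  proof -
    have "Suc (Suc j) mod q = j mod q" using that by (metis mod_Suc_eq)
    then have "[j + 2 = j + 0] (mod q)" by (simp add: cong_def)
    then have "[2 = 0] (mod q)" by (metis cong_add_lcancel_nat)
    then show False using q by (simp add: cong_def)
  qed
  moreover have "Suc i mod q = Suc j mod q" if "i mod q = j mod q"
    using that by (metis mod_Suc_eq)
  ultimately show ?thesis
    by (auto simp: doubleton_eq_iff v)
qed

lemma closed_seq_inj: "closed_seq q v \<Longrightarrow> inj_on v {..<q}"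
  by (auto simp: closed_seq_def inj_on_def)

lemma closed_seq_edge_inj: "closed_seq q v \<Longrightarrow> inj_on (\<lambda>i. {v i, v (Suc i)}) {..<q}"
  by (rule inj_onI) (simp add: closed_seq_edge_eq_iff)

lemma card_verts_seq_graph: "closed_seq q v \<Longrightarrow> card (range v) = q"
  by (simp add: closed_seq_range card_image closed_seq_inj)

lemma card_edges_seq_graph: "closed_seq q v \<Longrightarrow> card (edges (seq_graph v)) = q"
  using closed_seq_edges[of q v] by (simp add: card_image closed_seq_edge_inj del: edges_seq_graph)

text \<open>The bridge to the definition by lists: a list is continued periodically by reading the
  index modulo its length, and a periodic sequence is cut to its first period.\<close>

lemma cycles_iff:
  "C \<in> cycles G \<longleftrightarrow> (\<exists>q v. closed_seq q v \<and> C = seq_graph v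
     \<and> range v \<subseteq> verts G \<and> edges (seq_graph v) \<subseteq> edges G)"
proof
  assume "C \<in> cycles G"
  then obtain p where C: "C = cycle_graph p" and p: "3 \<le> length p" "distinct p"
    and sub: "verts C \<subseteq> verts G" "edges C \<subseteq> edges G"
    by (auto simp: cycles_def)
  define v where "v i = p ! (i mod length p)" for i
  let ?q = "length p"
  have cs: "closed_seq ?q v"
    unfolding closed_seq_def
  proof (intro conjI allI)
    have "0 < ?q" using p by linarith
    then show "v i = v j \<longleftrightarrow> i mod ?q = j mod ?q" for i j
      using p(2) nth_eq_iff_index_eq[of p "i mod ?q" "j mod ?q"] by (simp add: v_def)
  qed (use p in simp)
  have "range v = set p"
    using closed_seq_range[OF cs] p by (auto simp: v_def in_set_conv_nth image_iff)
  moreover have "edges (seq_graph v) = edges C"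
    unfolding closed_seq_edges[OF cs] C cycle_graph_def by (auto simp: v_def)
  ultimately have "C = seq_graph v" by (simp add: C cycle_graph_def seq_graph_def)
  then show "\<exists>q v. closed_seq q v \<and> C = seq_graph v
     \<and> range v \<subseteq> verts G \<and> edges (seq_graph v) \<subseteq> edges G"
    using cs sub by force
next
  assume "\<exists>q v. closed_seq q v \<and> C = seq_graph v
     \<and> range v \<subseteq> verts G \<and> edges (seq_graph v) \<subseteq> edges G"
  then obtain q v where cs: "closed_seq q v" and C: "C = seq_graph v"
    and sub: "range v \<subseteq> verts G" "edges (seq_graph v) \<subseteq> edges G" by blast
  let ?p = "map v [0..<q]"
  have q: "3 \<le> q" using cs by (simp add: closed_seq_def)
  have "distinct ?p" using closed_seq_inj[OF cs] by (simp add: distinct_map atLeast0LessThan)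
  moreover have "cycle_graph ?p = C"
  proof -
    have "set ?p = range v" using closed_seq_range[OF cs] by (simp add: atLeast0LessThan)
    moreover have "{?p ! i, ?p ! (Suc i mod length ?p)} = {v i, v (Suc i)}" if "i < q" for i
      using that q closed_seq_mod[OF cs, of "Suc i"] by simp
    then have "(\<lambda>i. {?p ! i, ?p ! (Suc i mod length ?p)}) ` {..<q} = (\<lambda>i. {v i, v (Suc i)}) ` {..<q}"
      by (intro image_cong) auto
    moreover have "{{?p ! i, ?p ! (Suc i mod length ?p)} | i. i < length ?p}
        = (\<lambda>i. {?p ! i, ?p ! (Suc i mod length ?p)}) ` {..<q}"
      by (rule equalityI; rule subsetI) (simp_all del: nth_map, blast+)
    ultimately show ?thesis
      using closed_seq_edges[OF cs] by (simp add: cycle_graph_def C seq_graph_def)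
  qed
  moreover have "3 \<le> length ?p" using q by simp
  moreover have "verts C \<subseteq> verts G" "edges C \<subseteq> edges G" using sub C by simp_all
  ultimately show "C \<in> cycles G"
    unfolding cycles_def by (intro CollectI exI[of _ ?p]) metis
qed

lemma cycles_obtain_at:
  assumes "C \<in> cycles G" "x \<in> verts C"
  obtains q v where "closed_seq q v" "C = seq_graph v" "v 0 = x"
    "range v \<subseteq> verts G" "edges (seq_graph v) \<subseteq> edges G"
proof -
  obtain q v where cs: "closed_seq q v" "C = seq_graph v"
    and sub: "range v \<subseteq> verts G" "edges (seq_graph v) \<subseteq> edges G"
    using assms(1) unfolding cycles_iff by blast
  obtain k where "x = v k" using assms(2) cs by auto
  let ?w = "\<lambda>i. v (i + k)"
  have w: "closed_seq q ?w" "seq_graph ?w = seq_graph v"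
    using closed_seq_shift[OF cs(1)] by auto
  have "range ?w = range v" using w(2) by (metis verts_seq_graph)
  then show ?thesis
    using w cs(2) sub \<open>x = v k\<close> by (intro that[of q ?w]) simp_all
qed

lemma cycles_obtain_edge:
  assumes "C \<in> cycles G" "e \<in> edges C"
  obtains q v where "closed_seq q v" "C = seq_graph v" "e = {v 0, v (Suc 0)}"
    "range v \<subseteq> verts G" "edges (seq_graph v) \<subseteq> edges G"
proof -
  obtain q v where cs: "closed_seq q v" "C = seq_graph v"
    and sub: "range v \<subseteq> verts G" "edges (seq_graph v) \<subseteq> edges G"
    using assms(1) unfolding cycles_iff by blast
  obtain k where "e = {v k, v (Suc k)}" using assms(2) cs by auto
  let ?w = "\<lambda>i. v (i + k)"
  have w: "closed_seq q ?w" "seq_graph ?w = seq_graph v"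
    using closed_seq_shift[OF cs(1)] by auto
  have "range ?w = range v" using w(2) by (metis verts_seq_graph)
  then show ?thesis
    using w cs(2) sub \<open>e = {v k, v (Suc k)}\<close> by (intro that[of q ?w]) simp_all
qed

lemma cycles_verts: "C \<in> cycles G \<Longrightarrow> verts C \<subseteq> verts G"
  and cycles_edges: "C \<in> cycles G \<Longrightarrow> edges C \<subseteq> edges G"
  by (auto simp: cycles_def)

lemma cycle_edge_subset: "C \<in> cycles G \<Longrightarrow> e \<in> edges C \<Longrightarrow> e \<subseteq> verts C"
  unfolding cycles_iff by auto

lemma cycle_edge_at:
  assumes "C \<in> cycles G" "x \<in> verts C" shows "\<exists>e\<in>edges C. x \<in> e"
proof -
  obtain q v where "C = seq_graph v" "v 0 = x" by (rule cycles_obtain_at[OF assms])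
  then have "{x, v (Suc 0)} \<in> edges C" by auto
  then show ?thesis by blast
qed

lemma card_cycle_verts: "C \<in> cycles G \<Longrightarrow> card (verts C) = card (edges C)"
  and cycle_card_ge: "C \<in> cycles G \<Longrightarrow> 3 \<le> card (verts C)"
  and cycle_finite: "C \<in> cycles G \<Longrightarrow> finite (verts C)"
     "C \<in> cycles G \<Longrightarrow> finite (edges C)"
proof -
  assume "C \<in> cycles G"
  then obtain q v where cs: "closed_seq q v" and C: "C = seq_graph v"
    unfolding cycles_iff by blast
  show "card (verts C) = card (edges C)"
    using card_verts_seq_graph[OF cs] card_edges_seq_graph[OF cs] by (simp add: C)
  show "3 \<le> card (verts C)"
    using card_verts_seq_graph[OF cs] cs by (simp add: C closed_seq_def)
  show "finite (verts C)" using closed_seq_range[OF cs] by (simp add: C)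
  show "finite (edges C)" using closed_seq_edges[OF cs] by (simp add: C)
qed

lemma cycle_verts_nonempty: "C \<in> cycles G \<Longrightarrow> verts C \<noteq> {}"
  using cycle_card_ge[of C G] by auto

lemma cycles_mono:
  "verts G \<subseteq> verts H \<Longrightarrow> edges G \<subseteq> edges H \<Longrightarrow> cycles G \<subseteq> cycles H"
  by (fastforce simp: cycles_def)

section \<open>Deletion of edges and vertices\<close>

definition del_edges :: "'a graph \<Rightarrow> 'a set set \<Rightarrow> 'a graph" where
  "del_edges G F = \<lparr>verts = verts G, edges = edges G - F\<rparr>"

lemma verts_del_edges [simp]: "verts (del_edges G F) = verts G"
  and edges_del_edges [simp]: "edges (del_edges G F) = edges G - F"
  by (simp_all add: del_edges_def)

lemma verts_delete_verts [simp]: "verts (delete_verts G X) = verts G - X"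
  and edges_delete_verts [simp]: "edges (delete_verts G X) = {e \<in> edges G. e \<subseteq> verts G - X}"
  by (simp_all add: delete_verts_def)

lemma delete_delete_verts: "delete_verts (delete_verts G X) Y = delete_verts G (X \<union> Y)"
  unfolding delete_verts_def by auto

lemma cycles_del_edges: "cycles (del_edges G F) = {C \<in> cycles G. edges C \<inter> F = {}}"
  by (auto simp: cycles_def)

lemma cycles_delete_verts:
  "cycles (delete_verts G X) = {C \<in> cycles G. verts C \<inter> X = {}}"
proof (intro equalityI subsetI)
  fix C assume C: "C \<in> cycles (delete_verts G X)"
  then have "verts C \<subseteq> verts G - X" using cycles_verts by fastforce
  moreover have "C \<in> cycles G" using C cycles_mono[of "delete_verts G X" G] by auto
  ultimately show "C \<in> {C \<in> cycles G. verts C \<inter> X = {}}" by auto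
next
  fix C assume "C \<in> {C \<in> cycles G. verts C \<inter> X = {}}"
  then have C: "C \<in> cycles G" "verts C \<inter> X = {}" by auto
  have "edges C \<subseteq> edges (delete_verts G X)"
    using cycles_verts[OF C(1)] cycles_edges[OF C(1)] cycle_edge_subset[OF C(1)] C(2)
    by simp blast
  then show "C \<in> cycles (delete_verts G X)"
    using C cycles_verts[OF C(1)] unfolding cycles_def by auto
qed

lemma simple_graph_delete_verts: "simple_graph G \<Longrightarrow> simple_graph (delete_verts G X)"
  by (auto simp: simple_graph_def nsets_def)

lemma simple_graph_del_edges: "simple_graph G \<Longrightarrow> simple_graph (del_edges G F)"
  by (auto simp: simple_graph_def)

lemma simple_graph_finite:
  assumes "simple_graph G" shows "finite (verts G)" "finite (edges G)" "finite (cycles G)"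
proof -
  show V: "finite (verts G)" using assms by (simp add: simple_graph_def)
  have "edges G \<subseteq> Pow (verts G)" using assms by (auto simp: simple_graph_def nsets_def)
  then show E: "finite (edges G)" using V by (meson finite_Pow_iff finite_subset)
  have "cycles G \<subseteq> (\<lambda>(A, B). \<lparr>verts = A, edges = B\<rparr>) ` (Pow (verts G) \<times> Pow (edges G))"
  proof
    fix C assume C: "C \<in> cycles G"
    show "C \<in> (\<lambda>(A, B). \<lparr>verts = A, edges = B\<rparr>) ` (Pow (verts G) \<times> Pow (edges G))"
      using cycles_verts[OF C] cycles_edges[OF C] by (intro image_eqI[of _ _ "(verts C, edges C)"]) auto
  qed
  then show "finite (cycles G)" using V E by (meson finite_subset finite_imageI finite_SigmaI finite_Pow_iff)
qed

lemma simple_graph_edge: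
  assumes "simple_graph G" "{x, y} \<in> edges G"
  shows "x \<in> verts G" "y \<in> verts G" "x \<noteq> y"
  using assms by (auto simp: simple_graph_def nsets_def)

lemma simple_graph_edgeE:
  assumes "simple_graph G" "e \<in> edges G"
  obtains x y where "e = {x, y}" "x \<noteq> y" "x \<in> verts G" "y \<in> verts G"
  using assms by (auto simp: simple_graph_def nsets_def card_2_iff)

lemma cycles_disjointD:
  assumes "cycles_vertex_disjoint G" "C \<in> cycles G" "D \<in> cycles G" "x \<in> verts C" "x \<in> verts D"
  shows "C = D"
  using assms unfolding cycles_vertex_disjoint_def pairwise_def disjnt_def by auto

lemma simple_graph_edge_atE:
  assumes "simple_graph G" "e \<in> edges G" "x \<in> e"
  obtains y where "e = {x, y}" "y \<noteq> x" "y \<in> verts G"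
proof -
  obtain a b where ab: "e = {a, b}" "a \<noteq> b" "a \<in> verts G" "b \<in> verts G"
    by (rule simple_graph_edgeE[OF assms(1,2)])
  show ?thesis
  proof (cases "x = a")
    case True
    then show ?thesis using ab that[of b] by simp
  next
    case False
    then have "x = b" using ab(1) assms(3) by simp
    then show ?thesis using ab that[of a] by (simp add: insert_commute)
  qed
qed

section \<open>The cyclomatic number\<close>

lemma sym_adj_rel: "sym (adj_rel G)"
  by (auto simp: sym_def adj_rel_def insert_commute)

lemma equiv_adj_rel: "equiv UNIV ((adj_rel G)\<^sup>*)"
  by (auto simp: equiv_def refl_rtrancl trans_rtrancl intro: sym_rtrancl sym_adj_rel)

lemma adj_rel_del_edges:
  assumes "{u, v} \<in> edges G"
  shows "adj_rel G = insert (u, v) (insert (v, u) (adj_rel (del_edges G {{u, v}})))"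
  using assms by (auto simp: adj_rel_def doubleton_eq_iff insert_commute)

text \<open>Passing from \<open>R\<close> to \<open>R'\<close> fuses the classes of \<open>u\<close>
  and \<open>v\<close> and leaves all other classes alone. The product form of \<open>R'\<close> is
  what \<open>rtrancl_insert\<close> yields when both orientations of an edge are added to a
  symmetric relation with closure \<open>R\<close>.\<close>

lemma card_quotient_merge:
  assumes fin: "finite V" and u: "u \<in> V" and v: "v \<in> V" and R: "equiv UNIV R" and nr: "(u, v) \<notin> R"
    and R': "R' = R \<union> (R `` {u} \<union> R `` {v}) \<times> (R `` {u} \<union> R `` {v})"
  shows "card (V // R) = card (V // R') + 1"
proof -
  define K where "K = R `` {u} \<union> R `` {v}"
  have q: "\<And>S. V // S = (\<lambda>x. S `` {x}) ` V" by (auto simp: quotient_def)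
  have inK: "R' `` {x} = K" if "x \<in> K" for x
    using that R unfolding R' K_def equiv_def by (auto dest: symD transD)
  have notK: "R' `` {x} = R `` {x}" if "x \<notin> K" for x
    using that R unfolding R' K_def equiv_def by (auto dest: symD transD)
  have refl: "x \<in> R `` {x}" for x using R by (auto simp: equiv_def refl_on_def)
  have uK: "u \<in> K" "v \<in> K" using refl by (auto simp: K_def)
  define Q where "Q = (\<lambda>x. R `` {x}) ` (V - K)"
  have finQ: "finite Q" using fin by (simp add: Q_def)
  have split: "f ` V = f ` (V \<inter> K) \<union> f ` (V - K)" for f :: "'a \<Rightarrow> 'a set" by blast
  have "(\<lambda>x. R' `` {x}) ` (V \<inter> K) = {K}" using inK u uK by auto
  moreover have "(\<lambda>x. R' `` {x}) ` (V - K) = Q" unfolding Q_def using notK by (intro image_cong) auto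
  ultimately have "V // R' = insert K Q"
    unfolding q split[of "\<lambda>x. R' `` {x}"] by simp
  moreover have "K \<notin> Q" using refl by (auto simp: Q_def)
  ultimately have 1: "card (V // R') = card Q + 1" using finQ by simp
  have cls: "R `` {x} = R `` {u} \<or> R `` {x} = R `` {v}" if "x \<in> K" for x
    using that equiv_class_eq[OF R] by (auto simp: K_def)
  have "(\<lambda>x. R `` {x}) ` (V \<inter> K) = {R `` {u}, R `` {v}}"
    using cls u v uK by blast
  then have "V // R = insert (R `` {u}) (insert (R `` {v}) Q)"
    unfolding q split[of "\<lambda>x. R `` {x}"] Q_def by simp
  moreover have "R `` {u} \<noteq> R `` {v}" using nr eq_equiv_class[OF _ R, of u v] by auto
  moreover have "R `` {u} \<notin> Q" "R `` {v} \<notin> Q" using refl uK unfolding Q_def K_def by blast+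
  ultimately have "card (V // R) = card Q + 2" using finQ by simp
  then show ?thesis using 1 by simp
qed

lemma num_components_del_edge:
  assumes G: "simple_graph G" and e: "{u, v} \<in> edges G"
  shows "num_components (del_edges G {{u, v}})
    = num_components G + (if (u, v) \<in> (adj_rel (del_edges G {{u, v}}))\<^sup>* then 0 else 1)"
proof -
  let ?R = "(adj_rel (del_edges G {{u, v}}))\<^sup>*"
  note eq = equiv_adj_rel[of "del_edges G {{u, v}}"]
  have uv: "u \<in> verts G" "v \<in> verts G" using simple_graph_edge[OF G e] by auto
  have R': "(adj_rel G)\<^sup>* = ?R \<union> (?R `` {u} \<union> ?R `` {v}) \<times> (?R `` {u} \<union> ?R `` {v})"
    if "(u, v) \<notin> ?R"
    unfolding adj_rel_del_edges[OF e] rtrancl_insert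
    using eq that unfolding equiv_def by (auto dest: symD transD)
  have "(adj_rel G)\<^sup>* = ?R" if "(u, v) \<in> ?R"
    unfolding adj_rel_del_edges[OF e] rtrancl_insert
    using eq that unfolding equiv_def by (auto dest: symD transD)
  then show ?thesis
    using card_quotient_merge[OF simple_graph_finite(1)[OF G] uv eq _ R']
    by (auto simp: num_components_def)
qed

text \<open>The other edges of the cycle, walked from \<open>w (Suc 0)\<close> up to
  \<open>w q = w 0\<close>, connect the two ends.\<close>

lemma edge_on_cycle_imp_connected:
  assumes "C \<in> cycles G" "{u, v} \<in> edges C"
  shows "(u, v) \<in> (adj_rel (del_edges G {{u, v}}))\<^sup>*"
proof -
  obtain q w where w: "closed_seq q w" "{u, v} = {w 0, w (Suc 0)}"
    and sub: "edges (seq_graph w) \<subseteq> edges G"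
    by (rule cycles_obtain_edge[OF assms])
  let ?R = "(adj_rel (del_edges G {{u, v}}))\<^sup>*"
  have q: "3 \<le> q" using w(1) by (simp add: closed_seq_def)
  have "(w (Suc 0), w (Suc j)) \<in> ?R" if "j < q" for j
    using that
  proof (induction j)
    case (Suc j)
    have "{w (Suc j), w (Suc (Suc j))} \<noteq> {w 0, w (Suc 0)}"
      using closed_seq_edge_eq_iff[OF w(1), of "Suc j" 0] Suc.prems q by simp
    then have "(w (Suc j), w (Suc (Suc j))) \<in> adj_rel (del_edges G {{u, v}})"
      using sub w(2) by (auto simp: adj_rel_def)
    then show ?case using Suc by (simp add: rtrancl.rtrancl_into_rtrancl)
  qed simp
  from this[of "q - 1"] have "(w (Suc 0), w 0) \<in> ?R"
    using q closed_seq_mod[OF w(1), of q] by (simp del: w)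
  then have "(w 0, w (Suc 0)) \<in> ?R" "(w (Suc 0), w 0) \<in> ?R"
    using equiv_adj_rel[of "del_edges G {{u, v}}"] by (auto simp: equiv_def dest: symD)
  moreover have "(u, v) = (w 0, w (Suc 0)) \<or> (u, v) = (w (Suc 0), w 0)"
    using w(2) by (auto simp: doubleton_eq_iff)
  ultimately show ?thesis by metis
qed

text \<open>A connection that avoids the edge contains a path without repeated vertices, and the
  edge itself closes this path to a cycle.\<close>

lemma connected_imp_edge_on_cycle:
  assumes G: "simple_graph G" and e: "{u, v} \<in> edges G"
    and con: "(u, v) \<in> (adj_rel (del_edges G {{u, v}}))\<^sup>*"
  shows "\<exists>C\<in>cycles G. {u, v} \<in> edges C"
proof -
  let ?r = "\<lambda>x y. (x, y) \<in> adj_rel (del_edges G {{u, v}})"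
  have "?r\<^sup>*\<^sup>* u v" using con by (simp add: Enum.rtranclp_rtrancl_eq)
  then obtain xs0 where "rtrancl_path ?r u xs0 v" by (auto simp: rtranclp_eq_rtrancl_path)
  then obtain xs where path: "rtrancl_path ?r u xs v" and dist: "distinct (u # xs)"
    by (rule rtrancl_path_distinct)
  have uv: "u \<in> verts G" "u \<noteq> v" using simple_graph_edge[OF G e] by auto
  have ne: "xs \<noteq> []" using path uv(2) by (auto elim: rtrancl_path.cases)
  have last: "last xs = v" by (rule rtrancl_path_last[OF path ne])
  have step: "{(u # xs) ! i, xs ! i} \<in> edges G \<and> {(u # xs) ! i, xs ! i} \<noteq> {u, v}"
    if "i < length xs" for i
    using rtrancl_path_nth[OF path that] by (auto simp: adj_rel_def)
  let ?p = "u # xs"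
  \<comment> \<open>A path with a single step would be the deleted edge.\<close>
  have len: "3 \<le> length ?p"
  proof (rule ccontr)
    assume "\<not> 3 \<le> length ?p"
    then have "length xs = 1" using ne by (cases "length xs") auto
    then have "xs = [v]" using last by (auto simp: length_Suc_conv)
    then show False using step[of 0] by simp
  qed
  have ed: "{?p ! i, ?p ! (Suc i mod length ?p)} = (if i < length xs then {?p ! i, xs ! i} else {u, v})"
    if "i < length ?p" for i
  proof (cases "i < length xs")
    case False
    then have "i = length xs" using that by simp
    moreover have "?p ! length xs = v" using ne last by (simp add: last_conv_nth nth_Cons')
    ultimately show ?thesis by auto
  qed auto
  have "edges (cycle_graph ?p) \<subseteq> edges G"
    using ed step e by (force simp: cycle_graph_def)
  moreover have "verts (cycle_graph ?p) \<subseteq> verts G"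
  proof -
    have "xs ! i \<in> verts G" if "i < length xs" for i
      using step[OF that] simple_graph_edge[OF G] by blast
    then show ?thesis using uv by (auto simp: cycle_graph_def in_set_conv_nth)
  qed
  ultimately have "cycle_graph ?p \<in> cycles G"
    using len dist unfolding cycles_def by blast
  moreover have "{u, v} \<in> edges (cycle_graph ?p)"
  proof -
    have "{u, v} = {?p ! length xs, ?p ! (Suc (length xs) mod length ?p)} \<and> length xs < length ?p"
      using ed[of "length xs"] by simp
    then show ?thesis unfolding cycle_graph_def by (simp only: graph.simps mem_Collect_eq) blast
  qed
  ultimately show ?thesis by blast
qed

text \<open>Deleting a bridge lowers the number of edges and raises the number of components, so
  \<open>c\<close> is unchanged; any other edge lies on a cycle, and its deletion leaves the
  components alone. The later bounds on \<open>c\<close> rest on this dichotomy.\<close>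

lemma cyclomatic_del_edge:
  assumes G: "simple_graph G" and e: "e \<in> edges G"
  shows "cyclomatic_number (del_edges G {e})
    = cyclomatic_number G - (if \<exists>C\<in>cycles G. e \<in> edges C then 1 else 0)"
proof -
  obtain u v where uv: "e = {u, v}" by (rule simple_graph_edgeE[OF G e])
  have "card (edges G) = Suc (card (edges G - {e}))"
    using simple_graph_finite(2)[OF G] e by (metis card_Suc_Diff1)
  then show ?thesis
    using num_components_del_edge[OF G e[unfolded uv]] connected_imp_edge_on_cycle[OF G e[unfolded uv]]
      edge_on_cycle_imp_connected[of _ G u v]
    unfolding cyclomatic_number_def uv by auto
qed

lemma del_del_edges: "del_edges (del_edges G E) F = del_edges G (E \<union> F)"
  by (auto simp: del_edges_def)

lemma cyclomatic_del_edges_le: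
  assumes "simple_graph G"
  shows "cyclomatic_number (del_edges G F) \<le> cyclomatic_number G"
proof -
  have "finite D \<Longrightarrow> D \<subseteq> edges G \<Longrightarrow> cyclomatic_number (del_edges G D) \<le> cyclomatic_number G" for D
  proof (induction D rule: finite_induct)
    case empty
    then show ?case by (simp add: del_edges_def cyclomatic_number_def num_components_def adj_rel_def)
  next
    case (insert e D)
    have "cyclomatic_number (del_edges (del_edges G D) {e}) \<le> cyclomatic_number (del_edges G D)"
      using cyclomatic_del_edge[OF simple_graph_del_edges[OF assms], of e D] insert by auto
    then show ?case using insert by (simp add: del_del_edges Un_commute)
  qed
  from this[of "F \<inter> edges G"] show ?thesis
    using simple_graph_finite(2)[OF assms] by (simp add: del_edges_def Diff_Int)
qed

text \<open>The lost vertex and the lost one-vertex component cancel in \<open>c\<close>.\<close>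

lemma cyclomatic_delete_isolated:
  assumes G: "simple_graph G" and x: "x \<in> verts G" and iso: "\<forall>e\<in>edges G. x \<notin> e"
  shows "cyclomatic_number (delete_verts G {x}) = cyclomatic_number G"
proof -
  have E: "edges (delete_verts G {x}) = edges G"
    using G iso by (auto simp: simple_graph_def nsets_def)
  then have r: "adj_rel (delete_verts G {x}) = adj_rel G" by (simp add: adj_rel_def)
  let ?R = "(adj_rel G)\<^sup>*"
  have "(x, y) \<notin> adj_rel G" for y using iso by (auto simp: adj_rel_def)
  then have Rx: "?R `` {x} = {x}" by (auto elim: converse_rtranclE)
  have "verts G // ?R = insert {x} ((verts G - {x}) // ?R)"
    using x Rx by (auto simp: quotient_def)
  moreover have "{x} \<notin> (verts G - {x}) // ?R" by (auto simp: quotient_def)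
  moreover have "finite ((verts G - {x}) // ?R)"
    using simple_graph_finite(1)[OF G] by (auto simp: quotient_def)
  ultimately have "num_components G = Suc (num_components (delete_verts G {x}))"
    by (simp add: num_components_def r)
  moreover have "card (verts G) = Suc (card (verts G - {x}))"
    using simple_graph_finite(1)[OF G] x by (metis card_Suc_Diff1)
  ultimately show ?thesis by (simp add: cyclomatic_number_def E del: edges_delete_verts)
qed

text \<open>Vertex deletion splits into the removal of all edges at \<open>x\<close>, which the edge
  formula controls, and of a vertex that has become isolated.\<close>

lemma cyclomatic_delete_vert:
  assumes G: "simple_graph G" and x: "x \<in> verts G"
  shows "cyclomatic_number (delete_verts G {x}) = cyclomatic_number (del_edges G {e. x \<in> e})"
proof -
  have "delete_verts (del_edges G {e. x \<in> e}) {x} = delete_verts G {x}"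
    by (auto simp: delete_verts_def)
  moreover have "cyclomatic_number (delete_verts (del_edges G {e. x \<in> e}) {x})
      = cyclomatic_number (del_edges G {e. x \<in> e})"
    by (rule cyclomatic_delete_isolated[OF simple_graph_del_edges[OF G]]) (use x in auto)
  ultimately show ?thesis by (rule subst)
qed

lemma delete_verts_nonvert: "simple_graph G \<Longrightarrow> x \<notin> verts G \<Longrightarrow> delete_verts G {x} = G"
  by (cases G) (auto simp: delete_verts_def simple_graph_def nsets_def)

lemma delete_verts_empty [simp]: "simple_graph G \<Longrightarrow> delete_verts G {} = G"
  by (cases G) (auto simp: delete_verts_def simple_graph_def nsets_def)

lemma cyclomatic_delete_le:
  assumes G: "simple_graph G"
  shows "cyclomatic_number (delete_verts G X) \<le> cyclomatic_number G"
proof -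
  have one: "cyclomatic_number (delete_verts H {x}) \<le> cyclomatic_number H" if "simple_graph H" for H x
    using that delete_verts_nonvert[of H x] cyclomatic_delete_vert[of H x]
      cyclomatic_del_edges_le[of H "{e. x \<in> e}"] by (cases "x \<in> verts H") auto
  have "finite D \<Longrightarrow> cyclomatic_number (delete_verts G D) \<le> cyclomatic_number G" for D
  proof (induction D rule: finite_induct)
    case empty
    then show ?case using G by simp
  next
    case (insert x D)
    then show ?case
      using one[OF simple_graph_delete_verts[OF G], of D x] by (simp add: delete_delete_verts)
  qed
  from this[of "X \<inter> verts G"] show ?thesis
    using simple_graph_finite(1)[OF G] by (simp add: delete_verts_def Diff_Int)
qed

text \<open>Among the edges at \<open>x\<close>, one that lies on the cycle is removed first: this
  costs exactly one, and removing the others never raises \<open>c\<close>.\<close>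

lemma cyclomatic_delete_cycle_vert:
  assumes G: "simple_graph G" and C: "C \<in> cycles G" "x \<in> verts C"
  shows "cyclomatic_number (delete_verts G {x}) + 1 \<le> cyclomatic_number G"
proof -
  obtain e where e: "e \<in> edges C" "x \<in> e" using cycle_edge_at[OF C] by blast
  have eG: "e \<in> edges G" using e cycles_edges[OF C(1)] by blast
  have xG: "x \<in> verts G" using C cycles_verts by blast
  have "del_edges (del_edges G {e}) {e. x \<in> e} = del_edges G {e. x \<in> e}"
    using e(2) by (auto simp: del_edges_def)
  then have "cyclomatic_number (delete_verts G {x}) \<le> cyclomatic_number (del_edges G {e})"
    using cyclomatic_del_edges_le[OF simple_graph_del_edges[OF G], of "{e}" "{e. x \<in> e}"]
      cyclomatic_delete_vert[OF G xG] by simp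
  moreover have "\<exists>C\<in>cycles G. e \<in> edges C" using C(1) e(1) by blast
  ultimately show ?thesis using cyclomatic_del_edge[OF G eG] by simp
qed

text \<open>The edge \<open>e\<close> costs one because it lies on \<open>C\<close>. Since
  \<open>D\<close> avoids \<open>e\<close>, it is still a cycle afterwards, and deleting
  \<open>x\<close> costs another one.\<close>

lemma cyclomatic_delete_two_cycles_vert:
  assumes G: "simple_graph G" and C: "C \<in> cycles G" and D: "D \<in> cycles G"
    and x: "x \<in> verts D" "x \<in> e" "e \<in> edges C" "e \<notin> edges D"
  shows "cyclomatic_number (delete_verts G {x}) + 2 \<le> cyclomatic_number G"
proof -
  have eG: "e \<in> edges G" using x(3) cycles_edges[OF C] by blast
  have "delete_verts (del_edges G {e}) {x} = delete_verts G {x}"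
    using x(2) by (auto simp: delete_verts_def)
  moreover have "D \<in> cycles (del_edges G {e})" using D x(4) by (simp add: cycles_del_edges)
  moreover have "\<exists>C\<in>cycles G. e \<in> edges C" using C x(3) by blast
  ultimately show ?thesis
    using cyclomatic_delete_cycle_vert[OF simple_graph_del_edges[OF G], of D "{e}" x] x(1)
      cyclomatic_del_edge[OF G eG] by simp
qed

text \<open>Following the first cycle from the common vertex never leaves the second one.\<close>

lemma cycle_subset_if_locally:
  assumes C: "C \<in> cycles G" and D: "D \<in> cycles G" and x: "x \<in> verts C" "x \<in> verts D"
    and loc: "\<And>y e. y \<in> verts D \<Longrightarrow> y \<in> e \<Longrightarrow> e \<in> edges C \<Longrightarrow> e \<in> edges D"
  shows "verts C \<subseteq> verts D" "edges C \<subseteq> edges D"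
proof -
  obtain q v where v: "C = seq_graph v" "v 0 = x" by (rule cycles_obtain_at[OF C x(1)])
  have vD: "v i \<in> verts D" for i
  proof (induction i)
    case (Suc i)
    moreover have "{v i, v (Suc i)} \<in> edges C" by (auto simp: v)
    ultimately have "{v i, v (Suc i)} \<in> edges D" using loc by blast
    then show ?case using cycle_edge_subset[OF D] by blast
  qed (use x v in simp)
  then show "verts C \<subseteq> verts D" using v by auto
  show "edges C \<subseteq> edges D"
  proof
    fix e assume e: "e \<in> edges C"
    then obtain i where "e = {v i, v (Suc i)}" using v by auto
    then show "e \<in> edges D" using loc[OF vD[of i] _ e] by simp
  qed
qed

text \<open>A vertex where one cycle leaves another lies on the second cycle, which survives the removal of
  an edge of the first one at that vertex.\<close>

lemma intersecting_cycles_drop: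
  assumes G: "simple_graph G" and nd: "\<not> cycles_vertex_disjoint G"
  shows "\<exists>x\<in>verts G. cyclomatic_number (delete_verts G {x}) + 2 \<le> cyclomatic_number G"
proof (rule ccontr)
  assume neg: "\<not> ?thesis"
  obtain C D x where CD: "C \<in> cycles G" "D \<in> cycles G" "C \<noteq> D" "x \<in> verts C" "x \<in> verts D"
    using nd by (auto simp: cycles_vertex_disjoint_def pairwise_def disjnt_def)
  have loc: "e \<in> edges B" if "A \<in> cycles G" "B \<in> cycles G" "y \<in> verts B" "y \<in> e" "e \<in> edges A"
    for A B y e
  proof (rule ccontr)
    assume "e \<notin> edges B"
    then have "cyclomatic_number (delete_verts G {y}) + 2 \<le> cyclomatic_number G"
      using cyclomatic_delete_two_cycles_vert[OF G that(1,2,3,4,5)] by simp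
    then show False using neg that(2,3) cycles_verts by blast
  qed
  have "verts C \<subseteq> verts D \<and> edges C \<subseteq> edges D"
    using cycle_subset_if_locally[OF CD(1,2,4,5)] loc[OF CD(1,2)] by blast
  moreover have "verts D \<subseteq> verts C \<and> edges D \<subseteq> edges C"
    using cycle_subset_if_locally[OF CD(2,1,5,4)] loc[OF CD(2,1)] by blast
  ultimately have "verts C = verts D" "edges C = edges D" by auto
  then show False using CD(3) by (cases C, cases D) simp
qed

lemma cycles_vertex_disjoint_subset:
  "cycles G \<subseteq> cycles H \<Longrightarrow> cycles_vertex_disjoint H \<Longrightarrow> cycles_vertex_disjoint G"
  unfolding cycles_vertex_disjoint_def by (rule pairwise_subset)

text \<open>With disjoint cycles an edge lies on at most one cycle, so removing it lowers
  \<open>c\<close> and the number of cycles by the same amount, zero or one.\<close>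

lemma cyclomatic_eq_card_cycles:
  assumes "simple_graph G" "cycles_vertex_disjoint G"
  shows "cyclomatic_number G = int (card (cycles G))"
  using assms
proof (induction "card (edges G)" arbitrary: G rule: less_induct)
  case (less G)
  note fin = simple_graph_finite[OF less.prems(1)]
  show ?case
  proof (cases "edges G = {}")
    case True
    then have "adj_rel G = {}" by (simp add: adj_rel_def)
    then have "verts G // (adj_rel G)\<^sup>* = (\<lambda>x. {x}) ` verts G" by (auto simp: quotient_def)
    then have "num_components G = card (verts G)"
      unfolding num_components_def by (simp add: card_image)
    moreover have "cycles G = {}" unfolding cycles_iff[abs_def] using True
      by (auto simp: cycles_iff)
    ultimately show ?thesis using True by (simp add: cyclomatic_number_def)
  next
    case False
    then obtain e where e: "e \<in> edges G" by blast
    let ?H = "del_edges G {e}"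
    have cyc: "cycles ?H = {C \<in> cycles G. e \<notin> edges C}" by (simp add: cycles_del_edges)
    have "card (edges ?H) < card (edges G)" using card_Diff1_less[OF fin(2) e] by simp
    then have IH: "cyclomatic_number ?H = int (card (cycles ?H))"
      using less.hyps[of ?H] simple_graph_del_edges[OF less.prems(1)]
        cycles_vertex_disjoint_subset[of ?H G] less.prems(2) cyc by auto
    show ?thesis
    proof (cases "\<exists>C\<in>cycles G. e \<in> edges C")
      case True
      then obtain C where C: "C \<in> cycles G" "e \<in> edges C" by blast
      obtain u where u: "u \<in> e" using simple_graph_edgeE[OF less.prems(1) e] by blast
      have uniq: "D = C" if "D \<in> cycles G" "e \<in> edges D" for D
        using cycles_disjointD[OF less.prems(2) that(1) C(1), of u]
          cycle_edge_subset[OF that] cycle_edge_subset[OF C] u by blast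
      have "cycles ?H = cycles G - {C}" unfolding cyc using uniq C by blast
      then have "card (cycles G) = Suc (card (cycles ?H))" using card_Suc_Diff1[OF fin(3) C(1)] by simp
      then show ?thesis using IH cyclomatic_del_edge[OF less.prems(1) e] True by simp
    next
      case False
      then have "cycles ?H = cycles G" using cyc by auto
      then show ?thesis using IH cyclomatic_del_edge[OF less.prems(1) e] False by simp
    qed
  qed
qed

section \<open>Degree counting outside the cycles\<close>

lemma handshake:
  assumes "simple_graph G" "F \<subseteq> edges G"
  shows "(\<Sum>x\<in>verts G. card {e\<in>F. x \<in> e}) = 2 * card F"
proof -
  have fin: "finite (verts G)" "finite F"
    using simple_graph_finite[OF assms(1)] assms(2) finite_subset by auto
  have "(\<Sum>x\<in>verts G. card {e\<in>F. x \<in> e}) = (\<Sum>x\<in>verts G. \<Sum>e | e \<in> F \<and> x \<in> e. 1)" by simp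
  also have "\<dots> = (\<Sum>e\<in>F. \<Sum>x | x \<in> verts G \<and> x \<in> e. 1)"
    by (rule sum.swap_restrict[OF fin])
  also have "\<dots> = (\<Sum>e\<in>F. 2)"
  proof (rule sum.cong[OF refl])
    fix e assume "e \<in> F"
    then have "e \<subseteq> verts G" "card e = 2" using assms by (auto simp: simple_graph_def nsets_def)
    moreover from this have "{x \<in> verts G. x \<in> e} = e" by auto
    ultimately show "(\<Sum>x | x \<in> verts G \<and> x \<in> e. 1) = (2::nat)" by simp
  qed
  finally show ?thesis by simp
qed

definition cycle_verts :: "'a graph \<Rightarrow> 'a set" where
  "cycle_verts G = \<Union> (verts ` cycles G)"

definition cycle_edges :: "'a graph \<Rightarrow> 'a set set" where
  "cycle_edges G = \<Union> (edges ` cycles G)"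

lemma cycle_verts_subset: "cycle_verts G \<subseteq> verts G"
  and cycle_edges_subset: "cycle_edges G \<subseteq> edges G"
  unfolding cycle_verts_def cycle_edges_def using cycles_verts cycles_edges by fast+

lemma sum_cycle_verts:
  assumes "simple_graph G" "cycles_vertex_disjoint G"
  shows "sum f (cycle_verts G) = (\<Sum>C\<in>cycles G. sum f (verts C))"
  unfolding cycle_verts_def
  by (rule sum.UNION_disjoint)
    (use assms simple_graph_finite cycle_finite in
      \<open>auto simp: cycles_vertex_disjoint_def pairwise_def disjnt_def\<close>)

lemma card_cycle_verts_eq:
  assumes "simple_graph G" "cycles_vertex_disjoint G"
  shows "card (cycle_verts G) = (\<Sum>C\<in>cycles G. card (verts C))"
    and "card (cycle_edges G) = card (cycle_verts G)"
proof -
  show 1: "card (cycle_verts G) = (\<Sum>C\<in>cycles G. card (verts C))"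
    using sum_cycle_verts[OF assms, of "\<lambda>_. 1::nat"] by simp
  have "edges C \<inter> edges D = {}" if "C \<in> cycles G" "D \<in> cycles G" "C \<noteq> D" for C D
  proof (rule ccontr)
    assume "edges C \<inter> edges D \<noteq> {}"
    then obtain e where e: "e \<in> edges C" "e \<in> edges D" by blast
    have "e \<noteq> {}" using assms(1) e(1) cycles_edges[OF that(1)] by (auto simp: simple_graph_def nsets_def)
    then obtain u where "u \<in> e" by blast
    then have "u \<in> verts C" "u \<in> verts D"
      using cycle_edge_subset[OF that(1) e(1)] cycle_edge_subset[OF that(2) e(2)] by auto
    then show False using cycles_disjointD[OF assms(2) that(1,2)] that(3) by blast
  qed
  then have "card (cycle_edges G) = (\<Sum>C\<in>cycles G. card (edges C))"
    unfolding cycle_edges_def using simple_graph_finite[OF assms(1)] cycle_finite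
    by (intro card_UN_disjoint) auto
  then show "card (cycle_edges G) = card (cycle_verts G)"
    using 1 card_cycle_verts[of _ G] by simp
qed

text \<open>For disjoint cycles this encodes the degrees of the contracted forest: directly at a
  vertex on no cycle, and as a sum over the vertices of a cycle at the cyclic vertex.\<close>

definition outer_degree :: "'a graph \<Rightarrow> 'a \<Rightarrow> nat" where
  "outer_degree G x = card {e \<in> edges G - cycle_edges G. x \<in> e}"

text \<open>The handshake identity of the contracted forest. Disjoint cycles have as many edges as
  vertices in total, so these cancel from the formula for \<open>c\<close>: the edges outside the
  cycles plus the components are as many as the acyclic vertices plus the cycles.\<close>

lemma outer_degree_sum:
  assumes G: "simple_graph G" "cycles_vertex_disjoint G"
  shows "(\<Sum>x\<in>verts G - cycle_verts G. outer_degree G x)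
      + (\<Sum>C\<in>cycles G. \<Sum>x\<in>verts C. outer_degree G x) + 2 * num_components G
    = 2 * card (verts G - cycle_verts G) + 2 * card (cycles G)"
proof -
  note fin = simple_graph_finite[OF G(1)]
  have finU: "finite (cycle_verts G)" by (rule finite_subset[OF cycle_verts_subset fin(1)])
  have finEC: "finite (cycle_edges G)" by (rule finite_subset[OF cycle_edges_subset fin(2)])
  have "(\<Sum>x\<in>verts G. outer_degree G x) = 2 * card (edges G - cycle_edges G)"
    unfolding outer_degree_def by (rule handshake[OF G(1)]) auto
  moreover have "(\<Sum>x\<in>verts G. outer_degree G x)
    = (\<Sum>x\<in>verts G - cycle_verts G. outer_degree G x) + (\<Sum>x\<in>cycle_verts G. outer_degree G x)"
    by (rule sum.subset_diff[OF cycle_verts_subset fin(1)])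
  moreover have "card (edges G) = card (edges G - cycle_edges G) + card (cycle_verts G)"
    using card_Diff_subset[OF finEC cycle_edges_subset] card_mono[OF fin(2) cycle_edges_subset]
      card_cycle_verts_eq(2)[OF G] by simp
  moreover have "card (verts G) = card (verts G - cycle_verts G) + card (cycle_verts G)"
    using card_Diff_subset[OF finU cycle_verts_subset] card_mono[OF fin(1) cycle_verts_subset] by simp
  moreover have "card (edges G) + num_components G = card (verts G) + card (cycles G)"
    using cyclomatic_eq_card_cycles[OF G] unfolding cyclomatic_number_def by linarith
  ultimately show ?thesis
    using sum_cycle_verts[OF G, of "outer_degree G"] by linarith
qed

lemma num_components_pos:
  assumes "simple_graph G" "verts G \<noteq> {}"
  shows "0 < num_components G"
proof -
  have "finite (verts G // (adj_rel G)\<^sup>*)"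
    using simple_graph_finite(1)[OF assms(1)] by (auto simp: quotient_def)
  moreover have "verts G // (adj_rel G)\<^sup>* \<noteq> {}" using assms(2) by (auto simp: quotient_def)
  ultimately show ?thesis by (simp add: num_components_def card_gt_0_iff)
qed

definition vdegree :: "'a graph \<Rightarrow> 'a \<Rightarrow> nat" where
  "vdegree G x = card {e \<in> edges G. x \<in> e}"

lemma outer_degree_noncyclic:
  assumes "x \<notin> cycle_verts G"
  shows "outer_degree G x = vdegree G x"
proof -
  have "e \<notin> cycle_edges G" if "x \<in> e" for e
    using assms that cycle_edge_subset unfolding cycle_verts_def cycle_edges_def by blast
  then have "{e \<in> edges G - cycle_edges G. x \<in> e} = {e \<in> edges G. x \<in> e}" by auto
  then show ?thesis by (simp add: outer_degree_def vdegree_def)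
qed

text \<open>Otherwise all degrees of the contracted forest are at least two, while by
  \<open>outer_degree_sum\<close> their sum falls short of twice the number of its vertices by twice
  the number of components.\<close>

lemma low_degree_or_pendant_cycle:
  assumes G: "simple_graph G" "cycles_vertex_disjoint G" and ne: "verts G \<noteq> {}"
  shows "(\<exists>x\<in>verts G - cycle_verts G. vdegree G x \<le> 1)
    \<or> (\<exists>C\<in>cycles G. (\<Sum>x\<in>verts C. outer_degree G x) \<le> 1)"
proof (rule ccontr)
  assume neg: "\<not> ?thesis"
  have "(\<Sum>x\<in>verts G - cycle_verts G. 2) \<le> (\<Sum>x\<in>verts G - cycle_verts G. outer_degree G x)"
    using neg outer_degree_noncyclic[of _ G] by (intro sum_mono) (auto simp: not_le Suc_le_eq numeral_2_eq_2)
  moreover have "(\<Sum>C\<in>cycles G. 2) \<le> (\<Sum>C\<in>cycles G. \<Sum>x\<in>verts C. outer_degree G x)"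
    using neg by (intro sum_mono) (auto simp: not_le Suc_le_eq numeral_2_eq_2)
  ultimately show False
    using outer_degree_sum[OF G] num_components_pos[OF G(1) ne] by simp
qed

lemma acyclic_low_degree:
  assumes "simple_graph G" "cycles G = {}" "verts G \<noteq> {}"
  shows "\<exists>x\<in>verts G. vdegree G x \<le> 1"
  using low_degree_or_pendant_cycle[of G] assms by (auto simp: cycles_vertex_disjoint_def cycle_verts_def)

lemma degree_cases:
  assumes G: "simple_graph G" and d: "vdegree G x \<le> 1"
  obtains "\<And>e. e \<in> edges G \<Longrightarrow> x \<notin> e"
  | z where "x \<noteq> z" "z \<in> verts G" "x \<in> verts G" "{x, z} \<in> edges G"
      "\<And>e. e \<in> edges G \<Longrightarrow> x \<in> e \<Longrightarrow> e = {x, z}"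
proof (cases "vdegree G x = 0")
  case True
  then show ?thesis using that(1) simple_graph_finite(2)[OF G] by (auto simp: vdegree_def)
next
  case False
  then have "card {e \<in> edges G. x \<in> e} = 1" using d by (simp add: vdegree_def)
  then obtain e where e: "{e \<in> edges G. x \<in> e} = {e}" by (auto simp: card_1_singleton_iff)
  then have eG: "e \<in> edges G" "x \<in> e" by auto
  obtain a b where ab: "e = {a, b}" "a \<noteq> b" "a \<in> verts G" "b \<in> verts G"
    by (rule simple_graph_edgeE[OF G eG(1)])
  have uniq: "f = e" if "f \<in> edges G" "x \<in> f" for f using e that by blast
  show ?thesis
  proof (cases "x = a")
    case True
    then have "e = {x, b}" "x \<noteq> b" "x \<in> verts G" using ab by auto
    with that(2)[OF this(2) ab(4) this(3)] eG(1) uniq show ?thesis by metis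
  next
    case False
    then have "e = {x, a}" "x \<noteq> a" "x \<in> verts G" using ab eG by auto
    with that(2)[OF this(2) ab(3) this(3)] eG(1) uniq show ?thesis by metis
  qed
qed

lemma cycle_vertex_degree:
  assumes G: "simple_graph G" and C: "C \<in> cycles G" "x \<in> verts C"
  shows "2 \<le> vdegree G x"
proof -
  obtain q v where v: "closed_seq q v" "C = seq_graph v" "v 0 = x"
    and sub: "edges (seq_graph v) \<subseteq> edges G" by (rule cycles_obtain_at[OF C])
  have q: "3 \<le> q" using v(1) by (simp add: closed_seq_def)
  let ?e = "{v 0, v (Suc 0)}" and ?f = "{v (q - 1), v (Suc (q - 1))}"
  have ef: "?e \<noteq> ?f" using closed_seq_edge_eq_iff[OF v(1), of 0 "q - 1"] q by simp
  have "v (Suc (q - 1)) = x" using closed_seq_mod[OF v(1), of q] q v(3) by simp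
  moreover have "?e \<in> edges G" "?f \<in> edges G" using sub by auto
  ultimately have "{?e, ?f} \<subseteq> {e \<in> edges G. x \<in> e}" using v(3) by simp
  then show ?thesis
    using ef card_mono[of "{e \<in> edges G. x \<in> e}" "{?e, ?f}"] simple_graph_finite(2)[OF G]
    by (simp add: vdegree_def)
qed

section \<open>The rank of the adjacency matrix\<close>

lemma rank_le_card_rows:
  fixes A :: "real^'n^'m"
  assumes "\<And>i j. i \<notin> X \<Longrightarrow> A $ i $ j = 0"
  shows "rank A \<le> card X"
proof -
  have "range ((*v) A) \<subseteq> {y. \<forall>i. i \<notin> X \<longrightarrow> y $ i = 0}"
    using assms by (auto simp: matrix_vector_mult_def)
  then have "dim (range ((*v) A)) \<le> dim {y :: real^'m. \<forall>i. i \<notin> X \<longrightarrow> y $ i = 0}"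
    by (rule dim_subset)
  then show ?thesis using dim_substandard_cart[of X, where 'a = real] by (simp add: rank_dim_range dim_vec_eq)
qed

lemma rank_add_le:
  fixes A B :: "real^'n^'m"
  shows "rank (A + B) \<le> rank A + rank B"
proof -
  let ?S = "range ((*v) A)" and ?T = "range ((*v) B)"
  have sub: "subspace ?S" "subspace ?T"
    by (auto intro!: linear_subspace_image)
  have "range ((*v) (A + B)) \<subseteq> {x + y |x y. x \<in> ?S \<and> y \<in> ?T}"
    by (auto simp: matrix_vector_mult_add_rdistrib)
  then have "dim (range ((*v) (A + B))) \<le> dim {x + y |x y. x \<in> ?S \<and> y \<in> ?T}"
    by (rule dim_subset)
  then show ?thesis using dim_sums_Int[OF sub] by (simp add: rank_dim_range)
qed

lemma rank_sum_le:
  fixes A :: "'i \<Rightarrow> real^'n^'m"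
  assumes "finite I"
  shows "rank (\<Sum>i\<in>I. A i) \<le> (\<Sum>i\<in>I. rank (A i))"
  using assms
proof (induction I rule: finite_induct)
  case (insert i I)
  then show ?case using rank_add_le[of "A i" "\<Sum>i\<in>I. A i"] by simp
qed simp

text \<open>With \<open>P\<close> the coordinate projection onto the remaining vertices, the new
  matrix is \<open>P A P\<close>.\<close>

lemma rank_adj_delete_le:
  assumes "simple_graph G"
  shows "rank (adj_matrix (delete_verts G X) \<sigma>) \<le> rank (adj_matrix G \<sigma>)"
proof -
  let ?A = "adj_matrix G \<sigma>" and ?B = "adj_matrix (delete_verts G X) \<sigma>"
  define P :: "real^'a \<Rightarrow> real^'a" where "P x = (\<chi> i. if i \<in> verts G - X then x $ i else 0)" for x
  have P: "linear P" by (rule linearI) (auto simp: P_def vec_eq_iff)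
  have "?B *v x = P (?A *v P x)" for x
  proof (simp only: vec_eq_iff, rule allI)
    fix i
    show "(?B *v x) $ i = P (?A *v P x) $ i"
    proof (cases "i \<in> verts G - X")
      case True
      then have "?B $ i $ j * x $ j = ?A $ i $ j * P x $ j" for j
        using simple_graph_edge[OF assms, of i j] by (auto simp: adj_matrix_def P_def)
      then have "(?B *v x) $ i = (?A *v P x) $ i" by (simp add: matrix_vector_mult_def)
      then show ?thesis using True by (simp add: P_def[of "?A *v P x"])
    next
      case False
      then have "?B $ i $ j = 0" for j by (auto simp: adj_matrix_def)
      then have "(?B *v x) $ i = 0" by (simp add: matrix_vector_mult_def)
      then show ?thesis using False by (auto simp: P_def[of "?A *v P x"])
    qed
  qed
  then have "range ((*v) ?B) \<subseteq> P ` range ((*v) ?A)" by auto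
  then have "dim (range ((*v) ?B)) \<le> dim (P ` range ((*v) ?A))" by (rule dim_subset)
  also have "\<dots> \<le> dim (range ((*v) ?A))" by (rule dim_image_le[OF P])
  finally show ?thesis by (simp add: rank_dim_range)
qed

text \<open>The difference of the two matrices is supported on the rows and columns of
  \<open>X\<close>: \<open>R\<close> collects the rows and \<open>K\<close> the rest of the columns,
  each of rank at most \<open>card X\<close>.\<close>

lemma rank_adj_delete_ge:
  assumes "simple_graph G"
  shows "rank (adj_matrix G \<sigma>) \<le> rank (adj_matrix (delete_verts G X) \<sigma>) + 2 * card X"
proof -
  let ?A = "adj_matrix G \<sigma>"
  define R where "R = (\<chi> i j. if i \<in> X then ?A $ i $ j else 0)"
  define K where "K = (\<chi> i j. if i \<notin> X \<and> j \<in> X then ?A $ i $ j else 0)"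
  have "?A = adj_matrix (delete_verts G X) \<sigma> + (R + K)"
    using simple_graph_edge[OF assms] by (auto simp: vec_eq_iff R_def K_def adj_matrix_def)
  moreover have "rank R \<le> card X" by (rule rank_le_card_rows) (simp add: R_def)
  moreover have "rank K \<le> card X"
    unfolding rank_transpose[of K, symmetric]
    by (rule rank_le_card_rows) (simp add: K_def transpose_def)
  moreover have "rank (adj_matrix (delete_verts G X) \<sigma> + (R + K))
      \<le> rank (adj_matrix (delete_verts G X) \<sigma>) + (rank R + rank K)"
    using rank_add_le[of "adj_matrix (delete_verts G X) \<sigma>" "R + K"] rank_add_le[of R K]
    by (meson add_left_mono order_trans)
  ultimately show ?thesis by simp
qed

lemma signed_graph_imp_simple: "signed_graph G \<sigma> \<Longrightarrow> simple_graph G"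
  by (simp add: signed_graph_def)

lemma signed_graph_delete_verts: "signed_graph G \<sigma> \<Longrightarrow> signed_graph (delete_verts G X) \<sigma>"
  by (auto simp: signed_graph_def simple_graph_delete_verts)

lemma signed_graph_sign: "signed_graph G \<sigma> \<Longrightarrow> e \<in> edges G \<Longrightarrow> \<sigma> e = 1 \<or> \<sigma> e = -1"
  by (auto simp: signed_graph_def)

text \<open>The column of \<open>y\<close> is a multiple of \<open>axis z 1\<close>, and the column
  of \<open>z\<close> has a nonzero entry at \<open>y\<close>. The range of the smaller matrix lies
  in the range of the larger one and vanishes at \<open>y\<close> and \<open>z\<close>, so these two
  columns add two dimensions to it.\<close>

lemma rank_adj_pendant:
  assumes G: "signed_graph G \<sigma>" and yz: "{y, z} \<in> edges G"
    and pend: "\<And>e. e \<in> edges G \<Longrightarrow> y \<in> e \<Longrightarrow> e = {y, z}"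
  shows "rank (adj_matrix (delete_verts G {y, z}) \<sigma>) + 2 \<le> rank (adj_matrix G \<sigma>)"
proof -
  let ?A = "adj_matrix G \<sigma>" and ?B = "adj_matrix (delete_verts G {y, z}) \<sigma>"
  note sG = signed_graph_imp_simple[OF G]
  have ne: "y \<noteq> z" using simple_graph_edge[OF sG yz] by simp
  define s where "s = \<sigma> {y, z}"
  have s0: "s \<noteq> 0" using signed_graph_sign[OF G yz] by (auto simp: s_def)
  have yj: "{y, j} \<in> edges G \<longleftrightarrow> j = z" for j
    using pend[of "{y, j}"] yz by (auto simp: doubleton_eq_iff)
  have jy: "{j, y} \<in> edges G \<longleftrightarrow> j = z" for j
    using yj[of j] by (simp add: insert_commute)
  have loop: "{j, j} \<notin> edges G" for j using simple_graph_edge[OF sG, of j j] by auto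
  have Ay: "?A *v axis y 1 = s *\<^sub>R axis z 1"
    unfolding matrix_vector_mult_basis
    by (auto simp: column_def vec_eq_iff adj_matrix_def jy s_def axis_def insert_commute)
  define w where "w = ?A *v axis z 1"
  have w: "w $ y = s"
    unfolding w_def matrix_vector_mult_basis by (simp add: column_def adj_matrix_def yj s_def)
  let ?R = "range ((*v) ?A)" and ?T = "range ((*v) ?B)"
  have subR: "subspace ?R" and subT: "subspace ?T" by (auto intro!: linear_subspace_image)
  have "s *\<^sub>R axis z 1 \<in> ?R" using Ay by (metis rangeI)
  then have ez: "axis z 1 \<in> ?R"
    using subspace_scale[OF subR, of "s *\<^sub>R axis z 1" "1 / s"] s0 by simp
  have Tz: "t $ z = 0" and Ty: "t $ y = 0" if "t \<in> ?T" for t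
    using that by (auto simp: matrix_vector_mult_def adj_matrix_def)
  have "?B *v x \<in> ?R" for x
  proof -
    \<comment> \<open>After clearing the coordinates \<open>y\<close> and \<open>z\<close>, the
      image under \<open>A\<close> agrees with \<open>?B *v x\<close> everywhere except at
      \<open>z\<close>, and a multiple of \<open>axis z 1\<close> repairs that coordinate.\<close>
    define x' where "x' = (\<chi> i. if i = y \<or> i = z then 0 else x $ i)"
    have "?A *v x' = ?B *v x + ((?A *v x') $ z) *\<^sub>R axis z 1"
    proof (simp only: vec_eq_iff, rule allI)
      fix i
      show "(?A *v x') $ i = (?B *v x + ((?A *v x') $ z) *\<^sub>R axis z 1) $ i"
      proof (cases "i = z")
        case True
        then show ?thesis using Tz[of "?B *v x"] by (simp add: axis_def)
      next
        case iz: False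
        show ?thesis
        proof (cases "i = y")
          case True
          then show ?thesis using iz Ty[of "?B *v x"]
            by (auto simp: axis_def matrix_vector_mult_def adj_matrix_def yj x'_def intro!: sum.neutral)
        next
          case False
          then show ?thesis using iz simple_graph_edge[OF sG]
            by (auto simp: axis_def matrix_vector_mult_def adj_matrix_def x'_def intro!: sum.cong)
        qed
      qed
    qed
    then have "?B *v x = ?A *v x' - ((?A *v x') $ z) *\<^sub>R axis z 1" by (metis add_diff_cancel_right')
    also have "\<dots> \<in> ?R" using ez by (intro subspace_diff[OF subR] subspace_scale[OF subR]) auto
    finally show ?thesis .
  qed
  then have "insert w (insert (axis z 1) ?T) \<subseteq> ?R" using ez by (auto simp: w_def)
  then have "dim (insert w (insert (axis z 1) ?T)) \<le> dim ?R" by (rule dim_subset)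
  moreover have "axis z 1 \<notin> span ?T"
    using Tz[of "axis z 1"] subT by (metis axis_nth span_eq_iff zero_neq_one)
  moreover have "w \<notin> span (insert (axis z 1) ?T)"
  proof -
    have "subspace {t. t $ y = (0::real)}" by (auto simp: subspace_def)
    moreover have "insert (axis z 1) ?T \<subseteq> {t. t $ y = 0}" using ne Ty by (auto simp: axis_def)
    ultimately have "span (insert (axis z 1) ?T) \<subseteq> {t. t $ y = 0}" by (intro span_minimal)
    then show ?thesis using w s0 by auto
  qed
  ultimately show ?thesis by (simp add: dim_insert rank_dim_range)
qed

section \<open>Signed cycles: rank, length and sign\<close>

lemma closed_seq_Suc_cancel:
  assumes "closed_seq q v" shows "v (Suc i) = v (Suc j) \<longleftrightarrow> v i = v j"
proof -
  have "Suc i mod q = Suc j mod q \<longleftrightarrow> i mod q = j mod q"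
    using cong_add_rcancel_nat[of i 1 j q] by (simp add: cong_def)
  then show ?thesis using assms by (simp add: closed_seq_def)
qed

lemma closed_seq_adj:
  assumes cs: "closed_seq q v"
  shows "{v (Suc i), x} \<in> edges (seq_graph v) \<longleftrightarrow> x = v i \<or> x = v (Suc (Suc i))"
proof
  assume "{v (Suc i), x} \<in> edges (seq_graph v)"
  then obtain k where "{v (Suc i), x} = {v k, v (Suc k)}" by auto
  then consider "v (Suc i) = v k" "x = v (Suc k)" | "v (Suc i) = v (Suc k)" "x = v k"
    by (auto simp: doubleton_eq_iff)
  then show "x = v i \<or> x = v (Suc (Suc i))"
    using closed_seq_Suc_cancel[OF cs] by cases auto
next
  assume "x = v i \<or> x = v (Suc (Suc i))"
  then show "{v (Suc i), x} \<in> edges (seq_graph v)" by (auto simp: insert_commute)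
qed

lemma closed_seq_neq_Suc_Suc:
  assumes "closed_seq q v" shows "v i \<noteq> v (Suc (Suc i))"
proof
  assume "v i = v (Suc (Suc i))"
  then have "[i + 2 = i + 0] (mod q)" using assms by (simp add: closed_seq_def cong_def)
  then have "[2 = 0] (mod q)" by (metis cong_add_lcancel_nat)
  then show False using assms by (simp add: cong_def closed_seq_def)
qed

text \<open>The offset is free because the relations around the cycle start at different
  indices.\<close>

lemma cycle_sign_shift:
  assumes cs: "closed_seq q v"
  shows "cycle_sign \<sigma> (seq_graph v) = (\<Prod>i<q. \<sigma> {v (i + k), v (Suc (i + k))})"
proof -
  let ?w = "\<lambda>i. v (i + k)"
  have w: "closed_seq q ?w" "seq_graph ?w = seq_graph v" using closed_seq_shift[OF cs] by auto
  show ?thesis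
    unfolding w(2)[symmetric] cycle_sign_def closed_seq_edges[OF w(1)]
    using prod.reindex[OF closed_seq_edge_inj[OF w(1)], of \<sigma>] by simp
qed

text \<open>The vectors \<open>b (2 * j)\<close>, with suitable signs, are consecutive differences of a sequence that returns
  to its initial value, so they sum to zero.\<close>

lemma cyclic_span:
  fixes u :: "nat \<Rightarrow> 'a :: real_vector" and s :: "nat \<Rightarrow> real"
  assumes s: "\<And>i. s i = 1 \<or> s i = -1" and h: "0 < h"
    and per: "s (2 * h) = s 0" "u (2 * h) = u 0"
    and sign: "(-1) ^ h * (\<Prod>i<2 * h. s (Suc i)) = 1"
    and b: "\<And>i. b i = s (Suc i) *\<^sub>R u (Suc (Suc i)) + s i *\<^sub>R u i"
  shows "b 0 \<in> span ((\<lambda>j. b (2 * j)) ` {1..<h})"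
proof -
  \<comment> \<open>The solution of \<open>c (Suc j) * s (2 * j + 2) = - c j * s (2 * j + 1)\<close>
    with \<open>c 0 = 1\<close>, which makes the \<open>u\<close>-terms of consecutive summands
    cancel. The assumption \<open>sign\<close> says \<open>c h = 1\<close>, so that
    \<open>g h = g 0\<close>.\<close>
  define c where "c j = (-1) ^ j * (\<Prod>i<2 * j. s (Suc i))" for j
  define g where "g j = (c j * s (2 * j)) *\<^sub>R u (2 * j)" for j
  have sq: "s i * s i = 1" for i using s[of i] by auto
  have "c j *\<^sub>R b (2 * j) = g j - g (Suc j)" for j
  proof -
    have "c (Suc j) * s (2 * Suc j) = - c j * s (Suc (2 * j))"
      using sq[of "Suc (Suc (2 * j))"] by (simp add: c_def algebra_simps)
    then show ?thesis by (simp add: g_def b algebra_simps scaleR_add_right)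
  qed
  then have "(\<Sum>j<h. c j *\<^sub>R b (2 * j)) = g 0 - g h"
    by (simp add: sum_lessThan_telescope')
  also have "\<dots> = 0" using per sign by (simp add: g_def c_def)
  finally have "b 0 + (\<Sum>j\<in>{1..<h}. c j *\<^sub>R b (2 * j)) = 0"
    using h by (simp add: lessThan_atLeast0 sum.atLeast_Suc_lessThan c_def)
  then have "b 0 = - (\<Sum>j\<in>{1..<h}. c j *\<^sub>R b (2 * j))" by (simp add: eq_neg_iff_add_eq_0)
  then show ?thesis
    by (simp only:) (intro span_neg span_sum span_scale span_base, auto)
qed

lemma seq_graph_column:
  assumes cs: "closed_seq q v"
  shows "column (v (Suc i)) (adj_matrix (seq_graph v) \<sigma>)
    = \<sigma> {v (Suc i), v (Suc (Suc i))} *\<^sub>R axis (v (Suc (Suc i))) 1 + \<sigma> {v i, v (Suc i)} *\<^sub>R axis (v i) 1"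
proof -
  have "{k, v (Suc i)} \<in> edges (seq_graph v) \<longleftrightarrow> k = v i \<or> k = v (Suc (Suc i))" for k
    using closed_seq_adj[OF cs, of i k] by (simp add: insert_commute)
  then show ?thesis
    using closed_seq_neq_Suc_Suc[OF cs, of i]
    by (auto simp: vec_eq_iff column_def adj_matrix_def axis_def insert_commute simp del: edges_seq_graph)
qed

text \<open>The column at \<open>v (Suc i)\<close> involves only positions \<open>i\<close> and
  \<open>i + 2\<close>. For even length the columns therefore fall into two classes by parity, and
  the sign condition gives a linear relation within each. Hence \<open>b 0\<close> and
  \<open>b 1\<close> are redundant, and \<open>q - 2\<close> columns span the range.\<close>

lemma rank_cycle_le:
  fixes C :: "'v::finite graph"
  assumes C: "C \<in> cycles G" and G: "signed_graph G \<sigma>"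
    and h: "cycle_length C = 2 * h" and sign: "cycle_sign \<sigma> C = (-1) ^ h"
  shows "rank (adj_matrix C \<sigma>) + 2 \<le> cycle_length C"
proof -
  obtain q v where cs: "closed_seq q v" and Cv: "C = seq_graph v"
    and sub: "edges (seq_graph v) \<subseteq> edges G"
    using C unfolding cycles_iff by blast
  have q: "q = 2 * h" "3 \<le> q"
    using h card_edges_seq_graph[OF cs] cs unfolding cycle_length_def Cv closed_seq_def by auto
  have h2: "2 \<le> h" using q by linarith
  define s where "s i = \<sigma> {v i, v (Suc i)}" for i
  define u where "u i = (axis (v i) 1 :: real^'v)" for i
  define b where "b i = s (Suc i) *\<^sub>R u (Suc (Suc i)) + s i *\<^sub>R u i" for i
  let ?A = "adj_matrix C \<sigma>"
  have col: "column (v (Suc i)) ?A = b i" for i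
    unfolding Cv seq_graph_column[OF cs] b_def s_def u_def ..
  have s1: "s i = 1 \<or> s i = -1" for i
    using signed_graph_sign[OF G] sub unfolding s_def by auto
  have per: "v (i + q) = v i" "v (Suc (i + q)) = v (Suc i)" for i
  proof -
    show *: "v (i + q) = v i" for i
      using closed_seq_mod[OF cs, of "i + q"] closed_seq_mod[OF cs, of i] by simp
    show "v (Suc (i + q)) = v (Suc i)" using *[of "Suc i"] by simp
  qed
  have sg: "(-1) ^ h * (\<Prod>i<2 * h. s (i + k)) = 1" for k
  proof -
    have "(\<Prod>i<2 * h. s (i + k)) = (-1) ^ h"
      using cycle_sign_shift[OF cs, of \<sigma> k] sign unfolding Cv q s_def by simp
    then show ?thesis by (simp flip: power_mult_distrib)
  qed
  have 0: "b 0 \<in> span ((\<lambda>j. b (2 * j)) ` {1..<h})"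
    using h2 per[of 0] sg[of 1] by (intro cyclic_span[of s h u b] s1) (auto simp: b_def s_def u_def q)
  \<comment> \<open>The same relation for the sequence advanced by one; the signs in
    \<open>cyclic_span\<close> are advanced once more, hence the offset 2.\<close>
  have 1: "b (Suc 0) \<in> span ((\<lambda>j. b (Suc (2 * j))) ` {1..<h})"
    using h2 per[of 1] sg[of 2] s1
    by (intro cyclic_span[of "\<lambda>i. s (Suc i)" h "\<lambda>i. u (Suc i)" "\<lambda>i. b (Suc i)"])
      (auto simp: b_def s_def u_def q)
  let ?W = "b ` {2..<q}"
  have "(\<lambda>j. b (2 * j)) ` {1..<h} \<subseteq> ?W" "(\<lambda>j. b (Suc (2 * j))) ` {1..<h} \<subseteq> ?W"
    using q by force+
  then have b01: "b 0 \<in> span ?W" "b (Suc 0) \<in> span ?W"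
    using 0 1 span_mono by blast+
  have bi: "b i \<in> span ?W" if "i < q" for i
  proof (cases "2 \<le> i")
    case True
    then show ?thesis using that by (intro span_base) auto
  next
    case False
    then have "i = 0 \<or> i = Suc 0" by auto
    then show ?thesis using b01 by auto
  qed
  have "columns ?A \<subseteq> span ?W"
  proof
    fix x assume "x \<in> columns ?A"
    then obtain j where j: "x = column j ?A" by (auto simp: columns_def)
    show "x \<in> span ?W"
    proof (cases "j \<in> range v")
      case True
      \<comment> \<open>A full period is added so that the index has a predecessor.\<close>
      then obtain k where "j = v (k + q)" using per(1) by (metis rangeE)
      then have "j = v (Suc (k + q - 1))" using q by simp
      also have "\<dots> = v (Suc ((k + q - 1) mod q))" using closed_seq_Suc_mod[OF cs] by simp
      finally show ?thesis using bi[of "(k + q - 1) mod q"] q col j by simp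
    next
      case False
      then have "{i, j} \<notin> edges C" for i using cycle_edge_subset[OF C, of "{i, j}"] Cv by auto
      then have "x = 0" by (simp add: j column_def adj_matrix_def vec_eq_iff)
      then show ?thesis by (simp add: span_zero)
    qed
  qed
  then have "dim (columns ?A) \<le> card ?W" by (intro dim_le_card) auto
  also have "\<dots> \<le> q - 2" using card_image_le[of "{2..<q}" b] by simp
  finally show ?thesis using q h by (simp add: column_rank_def)
qed

text \<open>A kernel vector on the cycle satisfies
  \<open>y (i + 2) = - s i * s (i + 1) * y i\<close>. Going around the cycle reproduces a nonzero
  entry up to a factor built from \<open>-1\<close> and the sign of the cycle, and this factor must
  be 1.\<close>

lemma cycle_condition_if_rank_lt:
  fixes C :: "'v::finite graph"
  assumes C: "C \<in> cycles G" and G: "signed_graph G \<sigma>"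
    and rk: "rank (adj_matrix C \<sigma>) < cycle_length C"
  shows "\<exists>h. cycle_length C = 2 * h \<and> cycle_sign \<sigma> C = (-1) ^ h"
proof -
  obtain q v where cs: "closed_seq q v" and Cv: "C = seq_graph v"
    and sub: "edges (seq_graph v) \<subseteq> edges G"
    using C unfolding cycles_iff by blast
  have q: "cycle_length C = q" "card (verts C) = q"
    using card_edges_seq_graph[OF cs] card_verts_seq_graph[OF cs] by (simp_all add: cycle_length_def Cv)
  let ?A = "adj_matrix C \<sigma>"
  \<comment> \<open>Vectors that vanish on the cycle are trivially in the kernel. The kernel vector
    is therefore sought in the complementary space of dimension \<open>q\<close>, on which the rank
    assumption excludes injectivity.\<close>
  let ?S = "{x :: real^'v. \<forall>i. i \<notin> verts C \<longrightarrow> x $ i = 0}"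
  have S: "subspace ?S" "dim ?S = q"
    using dim_substandard_cart[of "verts C", where 'a = real] q
    by (auto simp: subspace_def dim_vec_eq)
  have "\<not> inj_on ((*v) ?A) ?S"
  proof
    assume "inj_on ((*v) ?A) ?S"
    then have inj: "inj_on ((*v) ?A) (span ?S)" by (simp only: span_eq_iff[THEN iffD2, OF S(1)])
    have "dim ((*v) ?A ` ?S) = q"
      using dim_image_eq[OF matrix_vector_mul_linear inj] S(2) by (rule trans)
    moreover have "dim ((*v) ?A ` ?S) \<le> dim (range ((*v) ?A))" by (rule dim_subset) auto
    ultimately show False using rk q by (simp add: rank_dim_range)
  qed
  then obtain x where x: "x \<in> ?S" "?A *v x = 0" "x \<noteq> 0"
    using linear_injective_on_subspace_0[OF matrix_vector_mul_linear S(1)] by blast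
  define s where "s i = \<sigma> {v i, v (Suc i)}" for i
  define y where "y i = x $ v i" for i
  have s1: "s i = 1 \<or> s i = -1" for i
    using signed_graph_sign[OF G] sub unfolding s_def by auto
  have rec: "y (Suc (Suc i)) = - (s i * s (Suc i)) * y i" for i
  proof -
    have "0 = (?A *v x) $ v (Suc i)" using x(2) by simp
    also have "\<dots> = (\<Sum>j\<in>UNIV. if {v (Suc i), j} \<in> edges C then \<sigma> {v (Suc i), j} * x $ j else 0)"
      by (simp add: matrix_vector_mult_def adj_matrix_def if_distribR if_distrib cong: if_cong)
    also have "\<dots> = (\<Sum>j\<in>{v i, v (Suc (Suc i))}. \<sigma> {v (Suc i), j} * x $ j)"
      using closed_seq_adj[OF cs, of i] by (intro sum.mono_neutral_cong_right) (auto simp: Cv simp del: edges_seq_graph)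
    also have "\<dots> = s i * y i + s (Suc i) * y (Suc (Suc i))"
      using closed_seq_neq_Suc_Suc[OF cs, of i] by (simp add: s_def y_def insert_commute)
    finally show ?thesis using s1[of i] s1[of "Suc i"] by auto
  qed
  have iter: "y (i + 2 * m) = (-1) ^ m * (\<Prod>k<2 * m. s (k + i)) * y i" for i m
  proof (induction m)
    case (Suc m)
    have "y (i + 2 * Suc m) = - (s (2 * m + i) * s (Suc (2 * m + i))) * y (i + 2 * m)"
      using rec[of "i + 2 * m"] by (simp add: add.commute)
    then show ?case using Suc.IH by (simp add: algebra_simps)
  qed simp
  obtain i where i: "y i \<noteq> 0"
  proof -
    obtain j where j: "x $ j \<noteq> 0" using x(3) by (auto simp: vec_eq_iff)
    then have "j \<in> range v" using x(1) Cv by force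
    then obtain k where "j = v k" by blast
    then show ?thesis using j by (intro that[of k]) (simp add: y_def)
  qed
  have per: "v (i + q) = v i" for i
    using closed_seq_mod[OF cs, of "i + q"] closed_seq_mod[OF cs, of i] by simp
  have yper: "y (i + q) = y i" "y (i + 2 * q) = y i"
    using per[of i] per[of "i + q"] by (simp_all add: y_def mult_2 add.assoc)
  have sign: "(\<Prod>k<q. s (k + j)) = cycle_sign \<sigma> C" for j
    unfolding Cv cycle_sign_shift[OF cs, of \<sigma> j] s_def by simp
  have c1: "cycle_sign \<sigma> C * cycle_sign \<sigma> C = 1"
  proof -
    have "(\<Prod>k<m. s (k + 0)) * (\<Prod>k<m. s (k + 0)) = 1" for m
    proof (induction m)
      case (Suc m)
      then show ?case using s1[of m] by auto
    qed simp
    then show ?thesis using sign[of 0] by metis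
  qed
  show ?thesis
  proof (cases "even q")
    case True
    then obtain h where h: "q = 2 * h" by blast
    have "(-1) ^ h * cycle_sign \<sigma> C = 1"
      using iter[of i h] yper(1) i sign[of i] h by simp
    then have "cycle_sign \<sigma> C = (-1) ^ h"
      by (metis minus_one_mult_self mult.left_commute mult.right_neutral)
    then show ?thesis using h q by blast
  next
    case False
    \<comment> \<open>The recursion moves by two positions, so for odd \<open>q\<close> it returns
      after two rounds. Then every sign occurs twice, and the remaining factor
      \<open>(-1) ^ q = -1\<close> contradicts \<open>y i \<noteq> 0\<close>.\<close>
    have "(\<Prod>k<2 * q. s (k + i)) = (\<Prod>k<q. s (k + i)) * (\<Prod>k<q. s (k + (i + q)))"
      unfolding mult_2 lessThan_atLeast0
      by (simp add: prod.atLeastLessThan_concat[of 0 q "q + q", symmetric] prod.shift_bounds_nat_ivl[of _ 0 q q, simplified] add_ac)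
    then have "(\<Prod>k<2 * q. s (k + i)) = 1" using sign c1 by simp
    then have "y i = - y i" using iter[of i q] yper(2) False by simp
    then show ?thesis using i by simp
  qed
qed

section \<open>Independent sets and the excess\<close>

lemma finite_independent_cards:
  "finite (verts G) \<Longrightarrow> finite {card S | S. S \<subseteq> verts G \<and> indep S (edges G)}"
  by (rule finite_subset[of _ "card ` Pow (verts G)"]) auto

lemma independence_number_ge:
  assumes "finite (verts G)" "S \<subseteq> verts G" "indep S (edges G)"
  shows "card S \<le> independence_number G"
  unfolding independence_number_def using finite_independent_cards[OF assms(1)] assms(2,3)
  by (intro Max_ge) auto

lemma independence_number_obtain:
  assumes "finite (verts G)"
  obtains S where "S \<subseteq> verts G" "indep S (edges G)" "card S = independence_number G"
proof -
  have "independence_number G \<in> {card S | S. S \<subseteq> verts G \<and> indep S (edges G)}"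
    unfolding independence_number_def
    by (rule Max_in[OF finite_independent_cards[OF assms]]) auto
  then show ?thesis using that by auto
qed

lemma indep_alt: "indep S E \<longleftrightarrow> (\<forall>a\<in>S. \<forall>b\<in>S. a \<noteq> b \<longrightarrow> {a, b} \<notin> E)"
  by (simp add: indep_def)

lemma indep_delete_verts:
  "S \<subseteq> verts G - X \<Longrightarrow> indep S (edges (delete_verts G X)) \<longleftrightarrow> indep S (edges G)"
  by (auto simp: indep_def)

lemma independence_number_delete_le:
  assumes "finite (verts G)"
  shows "independence_number (delete_verts G X) \<le> independence_number G"
proof -
  obtain S where "S \<subseteq> verts G - X" "indep S (edges (delete_verts G X))"
    "card S = independence_number (delete_verts G X)"
    using independence_number_obtain[of "delete_verts G X"] assms by auto
  then show ?thesis
    using independence_number_ge[OF assms, of S] indep_delete_verts[of S G X] by auto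
qed

text \<open>All neighbours of \<open>x\<close> lie in \<open>X\<close>, so \<open>x\<close> can be
  added to any independent set of the rest.\<close>

lemma independence_number_delete_nbhd:
  assumes fin: "finite (verts G)" and x: "x \<in> verts G" "x \<in> X"
    and nb: "\<And>e. e \<in> edges G \<Longrightarrow> x \<in> e \<Longrightarrow> e \<subseteq> X"
  shows "independence_number (delete_verts G X) + 1 \<le> independence_number G"
proof -
  obtain S where S: "S \<subseteq> verts G - X" "indep S (edges (delete_verts G X))"
    "card S = independence_number (delete_verts G X)"
    using independence_number_obtain[of "delete_verts G X"] fin by auto
  have ind: "indep S (edges G)" using S(1,2) indep_delete_verts[of S G X] by simp
  have no: "{x, b} \<notin> edges G" "{b, x} \<notin> edges G" if "b \<in> S" for b
    using nb[of "{x, b}"] that S(1) by (auto simp: insert_commute)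
  have "indep (insert x S) (edges G)" using ind no unfolding indep_def by blast
  then have "card (insert x S) \<le> independence_number G"
    using x S(1) by (intro independence_number_ge[OF fin]) auto
  moreover have "finite S" "x \<notin> S" using S(1) x fin finite_subset by blast+
  ultimately show ?thesis using S(3) by simp
qed

text \<open>A chord and a part of \<open>C\<close> between its ends would close up to a second cycle
  through \<open>a\<close>.\<close>

lemma cycle_chordless:
  assumes G: "simple_graph G" "cycles_vertex_disjoint G" and C: "C \<in> cycles G"
    and ab: "a \<in> verts C" "b \<in> verts C" "{a, b} \<in> edges G"
  shows "{a, b} \<in> edges C"
proof (rule ccontr)
  assume nC: "{a, b} \<notin> edges C"
  let ?R = "(adj_rel (del_edges G {{a, b}}))\<^sup>*"
  obtain q v where v: "C = seq_graph v" "v 0 = a" and sub: "edges (seq_graph v) \<subseteq> edges G"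
    by (rule cycles_obtain_at[OF C ab(1)])
  have "(v 0, v i) \<in> ?R" for i
  proof (induction i)
    case (Suc i)
    have "{v i, v (Suc i)} \<in> edges C" by (simp add: v)
    then have "{v i, v (Suc i)} \<in> edges G" "{v i, v (Suc i)} \<noteq> {a, b}" using nC sub v by auto
    then have "(v i, v (Suc i)) \<in> adj_rel (del_edges G {{a, b}})" by (simp add: adj_rel_def)
    with Suc show ?case by (rule rtrancl.rtrancl_into_rtrancl)
  qed simp
  moreover obtain i where "b = v i" using ab(2) v by auto
  ultimately obtain D where D: "D \<in> cycles G" "{a, b} \<in> edges D"
    using connected_imp_edge_on_cycle[OF G(1) ab(3)] v(2) by blast
  then have "a \<in> verts D" using cycle_edge_subset by blast
  then show False using cycles_disjointD[OF G(2) C D(1) ab(1)] D(2) nC by simp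
qed

text \<open>The odd positions counted from \<open>x\<close>. Leaving \<open>x\<close> out keeps the
  set away from edges that leave \<open>C\<close> at \<open>x\<close>.\<close>

lemma cycle_alternating_set:
  assumes C: "C \<in> cycles G" and x: "x \<in> verts C"
  obtains A where "A \<subseteq> verts C" "x \<notin> A" "card A = cycle_length C div 2" "indep A (edges C)"
proof -
  obtain q v where cs: "closed_seq q v" and v: "C = seq_graph v" "v 0 = x"
    by (rule cycles_obtain_at[OF C x])
  have q: "cycle_length C = q" using card_edges_seq_graph[OF cs] by (simp add: cycle_length_def v)
  have inj: "v i = v j \<longleftrightarrow> i = j" if "i < q" "j < q" for i j
    using closed_seq_inj[OF cs] that by (auto simp: inj_on_def)
  define A where "A = (\<lambda>j. v (Suc (2 * j))) ` {..<q div 2}"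
  have lt: "Suc (2 * j) < q" if "j < q div 2" for j using that by linarith
  have "inj_on (\<lambda>j. v (Suc (2 * j))) {..<q div 2}"
    using inj[OF lt lt] by (auto simp: inj_on_def)
  then have "card A = q div 2" by (simp add: A_def card_image)
  moreover have "x \<notin> A" using inj[of 0] lt v(2) by (force simp: A_def)
  moreover have "indep A (edges C)"
    unfolding indep_alt
  proof (intro ballI impI notI)
    fix a b assume "a \<in> A" "b \<in> A" and e: "{a, b} \<in> edges C"
    then obtain i j where ij: "i < q div 2" "j < q div 2"
      "a = v (Suc (2 * i))" "b = v (Suc (2 * j))" by (auto simp: A_def)
    have "v (Suc (2 * j)) = v (2 * i) \<or> v (2 * j) = v (Suc (2 * i))"
      using e closed_seq_adj[OF cs, of "2 * i"] closed_seq_Suc_cancel[OF cs, of "2 * j"]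
      unfolding ij v by simp
    then have "Suc (2 * j) = 2 * i \<or> 2 * j = Suc (2 * i)"
      using inj lt[OF ij(1)] lt[OF ij(2)] by (meson Suc_lessD)
    then show False by presburger
  qed
  moreover have "A \<subseteq> verts C" by (auto simp: A_def v)
  ultimately show ?thesis using q that by simp
qed

lemma cycle_self: "C \<in> cycles G \<Longrightarrow> C \<in> cycles C"
  unfolding cycles_def by auto

lemma cycle_simple:
  assumes "simple_graph G" "C \<in> cycles G" shows "simple_graph C"
proof -
  have "e \<subseteq> verts C \<and> card e = 2" if "e \<in> edges C" for e
    using that cycle_edge_subset[OF assms(2)] cycles_edges[OF assms(2)] assms(1)
    by (auto simp: simple_graph_def nsets_def)
  then show ?thesis using cycle_finite[OF assms(2)] finite_subset
    by (fastforce simp: simple_graph_def nsets_def)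
qed

text \<open>Double counting of incidences: a vertex of \<open>I\<close> on \<open>C\<close> has at
  least two edges of \<open>C\<close>, and an edge of \<open>C\<close> has at most one end in
  \<open>I\<close>.\<close>

lemma card_independent_cycle_le:
  assumes G: "simple_graph G" and C: "C \<in> cycles G" and I: "indep I (edges G)"
  shows "2 * card (I \<inter> verts C) \<le> card (verts C)"
proof -
  note sC = cycle_simple[OF G C]
  have fin: "finite (I \<inter> verts C)" "finite (edges C)" using cycle_finite[OF C] by auto
  have "2 * card (I \<inter> verts C) = (\<Sum>x\<in>I \<inter> verts C. 2)" by simp
  also have "\<dots> \<le> (\<Sum>x\<in>I \<inter> verts C. vdegree C x)"
    using cycle_vertex_degree[OF sC cycle_self[OF C]] by (intro sum_mono) auto
  also have "\<dots> = (\<Sum>x\<in>I \<inter> verts C. \<Sum>e | e \<in> edges C \<and> x \<in> e. 1)" by (simp add: vdegree_def)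
  also have "\<dots> = (\<Sum>e\<in>edges C. \<Sum>x | x \<in> I \<inter> verts C \<and> x \<in> e. 1)"
    by (rule sum.swap_restrict[OF fin])
  also have "\<dots> \<le> (\<Sum>e\<in>edges C. 1)"
  proof (rule sum_mono)
    fix e assume e: "e \<in> edges C"
    then have eG: "e \<in> edges G" using cycles_edges[OF C] by blast
    obtain a b where ab: "e = {a, b}" "a \<noteq> b" by (rule simple_graph_edgeE[OF G eG])
    have "\<not> (a \<in> I \<and> b \<in> I)" using I eG ab by (auto simp: indep_def)
    then have "{x. x \<in> I \<inter> verts C \<and> x \<in> e} \<subseteq> {a} \<or> {x. x \<in> I \<inter> verts C \<and> x \<in> e} \<subseteq> {b}"
      using ab(1) by blast
    then have "card {x. x \<in> I \<inter> verts C \<and> x \<in> e} \<le> 1"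
      using card_mono[of "{a}"] card_mono[of "{b}"] by fastforce
    then show "(\<Sum>x | x \<in> I \<inter> verts C \<and> x \<in> e. 1) \<le> (1::nat)" by simp
  qed
  finally show ?thesis using card_cycle_verts[OF C] by simp
qed

lemma card_cycle_verts_Int:
  assumes "simple_graph G" "cycles_vertex_disjoint G"
  shows "card (I \<inter> cycle_verts G) = (\<Sum>C\<in>cycles G. card (I \<inter> verts C))"
proof -
  have "I \<inter> cycle_verts G = (\<Union>C\<in>cycles G. I \<inter> verts C)" by (auto simp: cycle_verts_def)
  moreover have "card (\<Union>C\<in>cycles G. I \<inter> verts C) = (\<Sum>C\<in>cycles G. card (I \<inter> verts C))"
    using simple_graph_finite[OF assms(1)] cycle_finite cycles_disjointD[OF assms(2)]
    by (intro card_UN_disjoint) blast+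
  ultimately show ?thesis by simp
qed

lemma independence_number_le_noncyclic:
  assumes G: "simple_graph G" "cycles_vertex_disjoint G"
  shows "2 * independence_number G
    \<le> 2 * independence_number (delete_verts G (cycle_verts G)) + card (cycle_verts G)"
proof -
  let ?U = "cycle_verts G"
  note fin = simple_graph_finite[OF G(1)]
  obtain I where I: "I \<subseteq> verts G" "indep I (edges G)" "card I = independence_number G"
    by (rule independence_number_obtain[OF fin(1)])
  have finI: "finite I" using I(1) fin(1) finite_subset by blast
  have "indep (I - ?U) (edges G)" using I(2) by (auto simp: indep_def)
  then have "card (I - ?U) \<le> independence_number (delete_verts G ?U)"
    using I(1) fin(1) indep_delete_verts[of "I - ?U" G ?U]
    by (intro independence_number_ge) auto
  moreover have "2 * card (I \<inter> ?U) \<le> card ?U"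
    unfolding card_cycle_verts_Int[OF G] card_cycle_verts_eq(1)[OF G] sum_distrib_left
    using card_independent_cycle_le[OF G(1) _ I(2)] by (rule sum_mono)
  moreover have "card I = card (I - ?U) + card (I \<inter> ?U)"
    using card_Int_Diff[OF finI, of ?U] by simp
  ultimately show ?thesis using I(3) by linarith
qed

text \<open>For disjoint cycles, condition (iii) says that some independent set of \<open>T\<^sub>G\<close> consists of all cyclic
  vertices and a maximum independent set \<open>S\<close> of \<open>[T\<^sub>G]\<close>; the following expresses this inside \<open>G\<close>.\<close>

definition spread :: "'a graph \<Rightarrow> 'a set \<Rightarrow> bool" where
  "spread G S \<longleftrightarrow> S \<subseteq> verts G - cycle_verts G
     \<and> independence_number (delete_verts G (cycle_verts G)) \<le> card S
     \<and> (\<forall>e\<in>edges G. e \<subseteq> S \<union> cycle_verts G \<longrightarrow> e \<in> cycle_edges G)"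

lemma cycle_edges_at:
  assumes G: "cycles_vertex_disjoint G" and C: "C \<in> cycles G" and e: "e \<in> cycle_edges G"
    and x: "x \<in> e" "x \<in> verts C"
  shows "e \<in> edges C"
proof -
  obtain D where D: "D \<in> cycles G" "e \<in> edges D" using e by (auto simp: cycle_edges_def)
  then show ?thesis using cycles_disjointD[OF G C D(1) x(2)] cycle_edge_subset[OF D] x(1) by blast
qed

text \<open>Half of every cycle can be added to \<open>S\<close>, because all edges within
  \<open>S\<close> and the cycles are cycle edges. This is the counterpart of
  \<open>independence_number_le_noncyclic\<close>, and the two bounds meet.\<close>

lemma spread_independence_number:
  assumes G: "simple_graph G" "cycles_vertex_disjoint G" and S: "spread G S"
    and even: "\<And>C. C \<in> cycles G \<Longrightarrow> even (cycle_length C)"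
  shows "2 * card S + card (cycle_verts G) \<le> 2 * independence_number G"
proof -
  let ?U = "cycle_verts G"
  note fin = simple_graph_finite[OF G(1)]
  have "\<exists>A. A \<subseteq> verts C \<and> card A = cycle_length C div 2 \<and> indep A (edges C)"
    if "C \<in> cycles G" for C
    using cycle_alternating_set[OF that] cycle_verts_nonempty[OF that] by (metis ex_in_conv)
  then obtain A where A: "\<And>C. C \<in> cycles G \<Longrightarrow> A C \<subseteq> verts C"
    "\<And>C. C \<in> cycles G \<Longrightarrow> card (A C) = cycle_length C div 2"
    "\<And>C. C \<in> cycles G \<Longrightarrow> indep (A C) (edges C)" by metis
  define J where "J = (\<Union>C\<in>cycles G. A C)"
  have JU: "J \<subseteq> ?U" using A(1) by (auto simp: J_def cycle_verts_def)
  have JC: "J \<inter> verts C \<subseteq> A C" if "C \<in> cycles G" for C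
    using A(1) cycles_disjointD[OF G(2)] that unfolding J_def by blast
  have cJ: "2 * card J = card ?U"
  proof -
    have "card J = (\<Sum>C\<in>cycles G. card (A C))"
      unfolding J_def using fin(3)
    proof (rule card_UN_disjoint)
      show "\<forall>C\<in>cycles G. finite (A C)" using A(1) cycle_finite(1) finite_subset by metis
      show "\<forall>C\<in>cycles G. \<forall>D\<in>cycles G. C \<noteq> D \<longrightarrow> A C \<inter> A D = {}"
        using A(1) cycles_disjointD[OF G(2)] by blast
    qed
    then have "2 * card J = (\<Sum>C\<in>cycles G. 2 * card (A C))" by (simp add: sum_distrib_left)
    also have "\<dots> = (\<Sum>C\<in>cycles G. card (verts C))"
      using A(2) even by (intro sum.cong) (auto simp: card_cycle_verts cycle_length_def)
    finally show ?thesis using card_cycle_verts_eq(1)[OF G] by simp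
  qed
  have SU: "S \<inter> ?U = {}" "S \<subseteq> verts G" using S by (auto simp: spread_def)
  have "indep (S \<union> J) (edges G)"
    unfolding indep_alt
  proof (intro ballI impI notI)
    fix a b assume ab: "a \<in> S \<union> J" "b \<in> S \<union> J" "a \<noteq> b" "{a, b} \<in> edges G"
    then have "{a, b} \<subseteq> S \<union> ?U" using JU by blast
    then have "{a, b} \<in> cycle_edges G" using S ab(4) by (simp add: spread_def)
    then obtain C where C: "C \<in> cycles G" "{a, b} \<in> edges C" by (auto simp: cycle_edges_def)
    then have "a \<in> verts C" "b \<in> verts C" using cycle_edge_subset by blast+
    moreover from this have "a \<notin> S" "b \<notin> S" using SU(1) C(1) unfolding cycle_verts_def by blast+
    ultimately have "a \<in> A C" "b \<in> A C" using JC[OF C(1)] ab(1,2) by blast+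
    then show False using A(3)[OF C(1)] C(2) ab(3) by (auto simp: indep_def)
  qed
  moreover have sub: "S \<subseteq> verts G" "J \<subseteq> verts G"
    using SU(2) subset_trans[OF JU cycle_verts_subset] by auto
  ultimately have "card (S \<union> J) \<le> independence_number G"
    by (intro independence_number_ge[OF fin(1)]) auto
  moreover have "card (S \<union> J) = card S + card J"
    using SU(1) JU sub fin(1) by (intro card_Un_disjoint) (auto intro: finite_subset)
  ultimately show ?thesis using cJ by linarith
qed

section \<open>The excess and its change under deletions\<close>

definition excess :: "'v::finite graph \<Rightarrow> ('v set \<Rightarrow> real) \<Rightarrow> int" where
  "excess G \<sigma> = int (rank (adj_matrix G \<sigma>)) + 2 * int (independence_number G)
     - 2 * int (card (verts G)) + 2 * cyclomatic_number G"

text \<open>The drop of \<open>c\<close> beyond one is kept in the bound: if the excess is zero, a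
  drop of two or more would make the smaller excess negative.\<close>

lemma excess_delete_vert:
  assumes G: "signed_graph G \<sigma>" and x: "x \<in> verts G"
  shows "excess (delete_verts G {x}) \<sigma>
    + 2 * (cyclomatic_number G - 1 - cyclomatic_number (delete_verts G {x})) \<le> excess G \<sigma>"
proof -
  note sG = signed_graph_imp_simple[OF G]
  have "card (verts G) = Suc (card (verts G - {x}))" using x by (metis card_Suc_Diff1 finite)
  then show ?thesis
    using rank_adj_delete_le[OF sG, of "{x}" \<sigma>] independence_number_delete_le[of G "{x}"]
    unfolding excess_def by simp
qed

lemma excess_delete_isolated:
  assumes G: "signed_graph G \<sigma>" and x: "x \<in> verts G" and iso: "\<And>e. e \<in> edges G \<Longrightarrow> x \<notin> e"
  shows "excess (delete_verts G {x}) \<sigma> \<le> excess G \<sigma>"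
proof -
  note sG = signed_graph_imp_simple[OF G]
  have "card (verts G) = Suc (card (verts G - {x}))" using x by (metis card_Suc_Diff1 finite)
  then show ?thesis
    using rank_adj_delete_le[OF sG, of "{x}" \<sigma>] independence_number_delete_nbhd[of G x "{x}"] x iso
      cyclomatic_delete_le[OF sG, of "{x}"]
    unfolding excess_def by simp
qed

text \<open>Rank and independence number pay for both vertices. The loss of \<open>c\<close> stays
  in the bound because its vanishing will show that \<open>z\<close> lies on no cycle.\<close>

lemma excess_delete_pendant:
  assumes G: "signed_graph G \<sigma>" and y: "y \<in> verts G" and yz: "{y, z} \<in> edges G"
    and pend: "\<And>e. e \<in> edges G \<Longrightarrow> y \<in> e \<Longrightarrow> e = {y, z}"
  shows "excess (delete_verts G {y, z}) \<sigma>
    + 2 * (cyclomatic_number G - cyclomatic_number (delete_verts G {y, z})) \<le> excess G \<sigma>"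
proof -
  note sG = signed_graph_imp_simple[OF G]
  have "y \<noteq> z" "z \<in> verts G" using simple_graph_edge[OF sG yz] by auto
  then have "card (verts G - {y, z}) = card (verts G) - 2" "2 \<le> card (verts G)"
    using y card_mono[of "verts G" "{y, z}"] by (simp_all add: card_Diff_subset)
  moreover have "independence_number (delete_verts G {y, z}) + 1 \<le> independence_number G"
    using y pend by (intro independence_number_delete_nbhd[of G y]) auto
  ultimately show ?thesis
    using rank_adj_pendant[OF G yz pend] unfolding excess_def by simp
qed

lemma excess_empty:
  fixes G :: "'v::finite graph"
  assumes G: "simple_graph G" and V: "verts G = {}"
  shows "0 \<le> excess G \<sigma>"
proof -
  have "edges G = {}" using G V by (auto simp: simple_graph_def nsets_def)
  then show ?thesis
    using V by (simp add: excess_def cyclomatic_number_def)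
qed

text \<open>A nonempty graph whose vertices all have degree at least two contains a cycle, so one of
  the deletions always applies.\<close>

lemma excess_nonneg:
  assumes "signed_graph G \<sigma>"
  shows "0 \<le> excess G \<sigma>"
  using assms
proof (induction "card (verts G)" arbitrary: G rule: less_induct)
  case (less G)
  note sG = signed_graph_imp_simple[OF less.prems]
  have IH: "0 \<le> excess (delete_verts G X) \<sigma>" if "x \<in> X" "x \<in> verts G" for X x
    using that by (intro less.hyps signed_graph_delete_verts less.prems) (auto intro!: psubset_card_mono)
  show ?case
  proof (cases "verts G = {}")
    case True
    then show ?thesis by (rule excess_empty[OF sG])
  next
    case ne: False
    show ?thesis
    proof (cases "\<exists>x\<in>verts G. vdegree G x \<le> 1")
      case True
      then obtain x where x: "x \<in> verts G" "vdegree G x \<le> 1" by blast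
      from degree_cases[OF sG x(2)] show ?thesis
      proof cases
        case 1
        then have "excess (delete_verts G {x}) \<sigma> \<le> excess G \<sigma>"
          by (rule excess_delete_isolated[OF less.prems x(1)])
        then show ?thesis using IH[of x "{x}"] x(1) by simp
      next
        case (2 z)
        have "excess (delete_verts G {x, z}) \<sigma>
            + 2 * (cyclomatic_number G - cyclomatic_number (delete_verts G {x, z})) \<le> excess G \<sigma>"
          by (rule excess_delete_pendant[OF less.prems x(1) 2(4)]) (rule 2(5))
        then show ?thesis
          using IH[of x "{x, z}"] x(1) cyclomatic_delete_le[OF sG, of "{x, z}"] by simp
      qed
    next
      case False
      then obtain C where C: "C \<in> cycles G" using acyclic_low_degree[OF sG _ ne] by blast
      then obtain x where x: "x \<in> verts C" using cycle_verts_nonempty by blast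
      then have xG: "x \<in> verts G" using cycles_verts[OF C] by blast
      show ?thesis
        using excess_delete_vert[OF less.prems xG] cyclomatic_delete_cycle_vert[OF sG C x]
          IH[of x "{x}"] xG by simp
    qed
  qed
qed

lemma excess_zero_cycles_disjoint:
  assumes G: "signed_graph G \<sigma>" and z: "excess G \<sigma> = 0"
  shows "cycles_vertex_disjoint G"
proof (rule ccontr)
  assume "\<not> cycles_vertex_disjoint G"
  then obtain x where x: "x \<in> verts G" "cyclomatic_number (delete_verts G {x}) + 2 \<le> cyclomatic_number G"
    using intersecting_cycles_drop[OF signed_graph_imp_simple[OF G]] by blast
  then show False
    using excess_delete_vert[OF G x(1)] excess_nonneg[OF signed_graph_delete_verts[OF G], of "{x}"] z by simp
qed

lemma excess_zero_delete_cycle_vert: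
  assumes G: "signed_graph G \<sigma>" and z: "excess G \<sigma> = 0" and C: "C \<in> cycles G" "x \<in> verts C"
  shows "excess (delete_verts G {x}) \<sigma> = 0"
proof -
  have "x \<in> verts G" using C cycles_verts by blast
  then show ?thesis
    using excess_delete_vert[OF G, of x] cyclomatic_delete_cycle_vert[OF signed_graph_imp_simple[OF G] C]
      excess_nonneg[OF signed_graph_delete_verts[OF G], of "{x}"] z by simp
qed

lemma excess_zero_delete_isolated:
  assumes "signed_graph G \<sigma>" "excess G \<sigma> = 0" "x \<in> verts G" "\<And>e. e \<in> edges G \<Longrightarrow> x \<notin> e"
  shows "excess (delete_verts G {x}) \<sigma> = 0"
  using excess_delete_isolated[OF assms(1,3,4)] excess_nonneg[OF signed_graph_delete_verts[OF assms(1)], of "{x}"]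
    assms(2) by simp

text \<open>Tightness leaves no room for \<open>c\<close> to drop, whereas deleting a vertex on a
  cycle lowers \<open>c\<close>; this is why \<open>z\<close> is acyclic.\<close>

lemma excess_zero_delete_pendant:
  assumes G: "signed_graph G \<sigma>" and z0: "excess G \<sigma> = 0" and y: "y \<in> verts G" and yz: "{y, z} \<in> edges G"
    and pend: "\<And>e. e \<in> edges G \<Longrightarrow> y \<in> e \<Longrightarrow> e = {y, z}"
  shows "excess (delete_verts G {y, z}) \<sigma> = 0" "z \<notin> cycle_verts G"
proof -
  note sG = signed_graph_imp_simple[OF G]
  have "excess (delete_verts G {y, z}) \<sigma>
      + 2 * (cyclomatic_number G - cyclomatic_number (delete_verts G {y, z})) \<le> excess G \<sigma>"
    by (rule excess_delete_pendant[OF G y yz]) (rule pend)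
  then have *: "excess (delete_verts G {y, z}) \<sigma> = 0 \<and>
      cyclomatic_number (delete_verts G {y, z}) = cyclomatic_number G"
    using excess_nonneg[OF signed_graph_delete_verts[OF G], of "{y, z}"]
      cyclomatic_delete_le[OF sG, of "{y, z}"] z0 by simp
  then show "excess (delete_verts G {y, z}) \<sigma> = 0" by simp
  show "z \<notin> cycle_verts G"
  proof
    assume "z \<in> cycle_verts G"
    then obtain C where "C \<in> cycles G" "z \<in> verts C" by (auto simp: cycle_verts_def)
    then have "cyclomatic_number (delete_verts G {z}) + 1 \<le> cyclomatic_number G"
      by (rule cyclomatic_delete_cycle_vert[OF sG])
    moreover have "delete_verts (delete_verts G {z}) {y} = delete_verts G {y, z}"
      by (simp add: delete_delete_verts insert_commute)
    ultimately show False
      using cyclomatic_delete_le[OF simple_graph_delete_verts[OF sG], of "{z}" "{y}"] * by simp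
  qed
qed

lemma low_degree_not_cycle_vert:
  assumes "simple_graph G" "vdegree G x \<le> 1"
  shows "x \<notin> cycle_verts G"
  using cycle_vertex_degree[OF assms(1)] assms(2) by (fastforce simp: cycle_verts_def)

section \<open>Graphs of excess zero\<close>

lemma cycles_delete_noncyclic:
  assumes "X \<inter> cycle_verts G = {}"
  shows "cycles (delete_verts G X) = cycles G"
  using assms by (auto simp: cycles_delete_verts cycle_verts_def)

lemma cycle_verts_delete_noncyclic:
  assumes "X \<inter> cycle_verts G = {}"
  shows "cycle_verts (delete_verts G X) = cycle_verts G"
    "cycle_edges (delete_verts G X) = cycle_edges G"
  using cycles_delete_noncyclic[OF assms] by (simp_all add: cycle_verts_def cycle_edges_def)

lemma cycles_delete_cycle:
  assumes "cycles_vertex_disjoint G" "C \<in> cycles G"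
  shows "cycles (delete_verts G (verts C)) = cycles G - {C}"
  unfolding cycles_delete_verts
  using cycles_disjointD[OF assms(1)] assms(2) cycle_verts_nonempty[of _ G] by blast

lemma cycle_verts_delete_cycle:
  assumes "cycles_vertex_disjoint G" "C \<in> cycles G"
  shows "cycle_verts (delete_verts G (verts C)) = cycle_verts G - verts C"
    "cycle_edges (delete_verts G (verts C)) \<subseteq> cycle_edges G"
proof -
  show "cycle_verts (delete_verts G (verts C)) = cycle_verts G - verts C"
    unfolding cycle_verts_def cycles_delete_cycle[OF assms]
    using cycles_disjointD[OF assms(1) assms(2)] by blast
  show "cycle_edges (delete_verts G (verts C)) \<subseteq> cycle_edges G"
    unfolding cycle_edges_def cycles_delete_cycle[OF assms] by blast
qed

lemma outer_degree_zero:
  assumes "simple_graph G" "outer_degree G x = 0" "e \<in> edges G" "x \<in> e"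
  shows "e \<in> cycle_edges G"
proof -
  have "{e \<in> edges G - cycle_edges G. x \<in> e} = {}"
    using assms(2) simple_graph_finite(2)[OF assms(1)] by (simp add: outer_degree_def)
  then show ?thesis using assms(3,4) by blast
qed

section \<open>Length and sign of the cycles\<close>

lemma rank_lt_if_excess_zero_cycle:
  assumes C: "C \<in> cycles C" and sC: "signed_graph C \<sigma>" and z: "excess C \<sigma> = 0"
    and uni: "cycles C = {C}"
  shows "rank (adj_matrix C \<sigma>) < cycle_length C"
proof -
  note s = signed_graph_imp_simple[OF sC]
  obtain x where x: "x \<in> verts C" using cycle_verts_nonempty[OF C] by blast
  obtain A where "A \<subseteq> verts C" "card A = cycle_length C div 2" "indep A (edges C)"
    by (rule cycle_alternating_set[OF C x])
  then have "cycle_length C div 2 \<le> independence_number C"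
    using independence_number_ge[of C A] by simp
  moreover have "cyclomatic_number C = 1"
    using cyclomatic_eq_card_cycles[OF s] uni by (simp add: cycles_vertex_disjoint_def)
  \<comment> \<open>Zero excess and \<open>c = 1\<close> give rank
    \<open>2q - 2 - 2\<alpha>\<close>, which is at most \<open>q - 1\<close> since
    \<open>2 * (q div 2) \<ge> q - 1\<close>. Odd lengths pass this bound; the kernel argument of
    \<open>cycle_condition_if_rank_lt\<close> excludes them.\<close>
  ultimately show ?thesis
    using z card_cycle_verts[OF C] unfolding excess_def cycle_length_def by linarith
qed

text \<open>Every deletion avoids \<open>C\<close>: vertices of degree at most one are off the
  cycles, their neighbours are so by tightness, and a vertex on another cycle is off
  \<open>C\<close> by disjointness. If no such deletion is possible, \<open>G\<close> equals
  \<open>C\<close>.\<close>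

lemma excess_zero_cycle_condition:
  assumes "signed_graph G \<sigma>" "excess G \<sigma> = 0" "C \<in> cycles G"
  shows "\<exists>h. cycle_length C = 2 * h \<and> cycle_sign \<sigma> C = (-1) ^ h"
  using assms
proof (induction "card (verts G)" arbitrary: G rule: less_induct)
  case (less G)
  note G = less.prems(1) and z0 = less.prems(2) and C = less.prems(3)
  note sG = signed_graph_imp_simple[OF G]
  have disj: "cycles_vertex_disjoint G" by (rule excess_zero_cycles_disjoint[OF G z0])
  have IH: ?case if "x \<in> X" "x \<in> verts G" "excess (delete_verts G X) \<sigma> = 0" "verts C \<inter> X = {}" for x X
  proof -
    have "card (verts (delete_verts G X)) < card (verts G)"
      using that(1,2) by (auto intro!: psubset_card_mono)
    moreover have "C \<in> cycles (delete_verts G X)" using C that(4) by (simp add: cycles_delete_verts)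
    ultimately show ?thesis using less.hyps signed_graph_delete_verts[OF G] that(3) by blast
  qed
  have CU: "verts C \<subseteq> cycle_verts G" using C by (auto simp: cycle_verts_def)
  show ?case
  proof (cases "\<exists>x\<in>verts G. vdegree G x \<le> 1")
    case True
    then obtain x where x: "x \<in> verts G" "vdegree G x \<le> 1" by blast
    have xU: "x \<notin> cycle_verts G" by (rule low_degree_not_cycle_vert[OF sG x(2)])
    from degree_cases[OF sG x(2)] show ?thesis
    proof cases
      case 1
      then have "excess (delete_verts G {x}) \<sigma> = 0"
        by (rule excess_zero_delete_isolated[OF G z0 x(1)])
      then show ?thesis using IH[of x "{x}"] x(1) xU CU by blast
    next
      case (2 z)
      have *: "excess (delete_verts G {x, z}) \<sigma> = 0"
        by (rule excess_zero_delete_pendant(1)[OF G z0 x(1) 2(4)]) (rule 2(5))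
      have "z \<notin> cycle_verts G"
        by (rule excess_zero_delete_pendant(2)[OF G z0 x(1) 2(4)]) (rule 2(5))
      then show ?thesis using * IH[of x "{x, z}"] x(1) xU CU by blast
    qed
  next
    case deg: False
    show ?thesis
    proof (cases "cycles G = {C}")
      case False
      then obtain D where D: "D \<in> cycles G" "D \<noteq> C" using C by blast
      then obtain x where x: "x \<in> verts D" using cycle_verts_nonempty by blast
      have "x \<notin> verts C" using cycles_disjointD[OF disj D(1) C x] D(2) by blast
      moreover have "x \<in> verts G" using x cycles_verts[OF D(1)] by blast
      ultimately show ?thesis
        using IH[of x "{x}"] excess_zero_delete_cycle_vert[OF G z0 D(1) x] by blast
    next
      case uni: True
      have U: "cycle_verts G = verts C" "cycle_edges G = edges C"
        using uni by (simp_all add: cycle_verts_def cycle_edges_def)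
      let ?N = "verts G - cycle_verts G"
      \<comment> \<open>With one cycle the degree sum is \<open>2 * card ?N + 2\<close> minus twice
        the number of components. The acyclic vertices already need \<open>2 * card ?N\<close>,
        which leaves nothing for edges that leave \<open>C\<close>.\<close>
      have "(\<Sum>x\<in>?N. 2) \<le> (\<Sum>x\<in>?N. outer_degree G x)"
      proof (rule sum_mono)
        fix x assume "x \<in> ?N"
        then show "2 \<le> outer_degree G x" using deg outer_degree_noncyclic[of x G] by fastforce
      qed
      then have "2 * card ?N \<le> (\<Sum>x\<in>?N. outer_degree G x)" by simp
      moreover have "0 < num_components G"
        using num_components_pos[OF sG] cycles_verts[OF C] cycle_verts_nonempty[OF C] by blast
      moreover have "(\<Sum>x\<in>?N. outer_degree G x) + (\<Sum>x\<in>verts C. outer_degree G x)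
          + 2 * num_components G = 2 * card ?N + 2"
        using outer_degree_sum[OF sG disj] unfolding uni by simp
      ultimately have "(\<Sum>x\<in>verts C. outer_degree G x) = 0" by linarith
      then have out: "e \<in> edges C" if "x \<in> verts C" "e \<in> edges G" "x \<in> e" for x e
        using that outer_degree_zero[OF sG, of x e] U cycle_finite(1)[OF C] by simp
      \<comment> \<open>The rest of the graph is acyclic and detached from \<open>C\<close>. Unless
        empty, it would have a vertex of degree at most one, against \<open>deg\<close>.\<close>
      have VC: "verts G = verts C"
      proof (rule ccontr)
        assume "verts G \<noteq> verts C"
        then have ne: "verts (delete_verts G (verts C)) \<noteq> {}" using cycles_verts[OF C] by auto
        have "cycles (delete_verts G (verts C)) = {}"
          using cycles_delete_cycle[OF disj C] uni by simp
        then obtain x where x: "x \<in> verts G - verts C" "vdegree (delete_verts G (verts C)) x \<le> 1"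
          using acyclic_low_degree[OF simple_graph_delete_verts[OF sG] _ ne] by auto
        have "e \<subseteq> verts G - verts C" if "e \<in> edges G" "x \<in> e" for e
        proof -
          have "e \<subseteq> verts G" using that(1) sG by (auto simp: simple_graph_def nsets_def)
          moreover have "e \<inter> verts C = {}"
            using out that x(1) cycle_edge_subset[OF C] by blast
          ultimately show ?thesis by blast
        qed
        then have "{e \<in> edges (delete_verts G (verts C)). x \<in> e} = {e \<in> edges G. x \<in> e}" by auto
        then have "vdegree G x \<le> 1" using x(2) by (simp add: vdegree_def)
        then show False using deg x(1) by blast
      qed
      have "edges G \<subseteq> edges C"
      proof
        fix e assume e: "e \<in> edges G"
        then obtain a b where "e = {a, b}" "a \<in> verts G" by (rule simple_graph_edgeE[OF sG])
        then show "e \<in> edges C" using out[of a e] e VC by simp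
      qed
      then have "edges G = edges C" using cycles_edges[OF C] by blast
      then have "G = C" using VC by (cases G, cases C) simp
      then show ?thesis
        using cycle_condition_if_rank_lt[OF C G] rank_lt_if_excess_zero_cycle[of C \<sigma>] C G z0 uni
        by simp
    qed
  qed
qed

section \<open>Pendant cycles and condition (iii)\<close>

lemma rank_adj_peel_cycle:
  fixes G :: "'v::finite graph"
  assumes G: "signed_graph G \<sigma>" and C: "C \<in> cycles G" and x: "x \<in> verts C"
    and even: "cycle_length C = 2 * h"
    and out: "\<And>e. e \<in> edges G \<Longrightarrow> e \<inter> verts C \<noteq> {} \<Longrightarrow> e \<in> edges C \<or> e \<inter> verts C = {x}"
  shows "rank (adj_matrix (delete_verts G (verts C - {x})) \<sigma>) + (2 * h - 2) \<le> rank (adj_matrix G \<sigma>)"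
proof -
  note sG = signed_graph_imp_simple[OF G]
  obtain q v where cs: "closed_seq q v" and v: "C = seq_graph v" "v 0 = x"
    and sub: "edges (seq_graph v) \<subseteq> edges G"
    by (rule cycles_obtain_at[OF C x])
  have q: "q = 2 * h" "3 \<le> q"
    using card_edges_seq_graph[OF cs] even cs by (auto simp: cycle_length_def v(1) closed_seq_def)
  have inj: "v i = v j \<longleftrightarrow> i = j" if "i < q" "j < q" for i j
    using closed_seq_inj[OF cs] that by (auto simp: inj_on_def)
  \<comment> \<open>Only \<open>x\<close> may have edges to the outside, so without
    \<open>v 1\<close> the rest of the cycle hangs on \<open>x\<close> as a path whose end
    \<open>v 2\<close> is pendant. It is stripped in \<open>h - 1\<close> pairs
    \<open>v (2 * k + 2)\<close>, \<open>v (2 * k + 3)\<close>, each worth rank 2; after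
    \<open>k\<close> pairs the positions from 1 to \<open>2 * k + 1\<close> are gone.\<close>
  have "k < h \<Longrightarrow> rank (adj_matrix (delete_verts G (v ` {1..2 * k + 1})) \<sigma>) + 2 * k
      \<le> rank (adj_matrix G \<sigma>)" for k
  proof (induction k)
    case 0
    then show ?case using rank_adj_delete_le[OF sG] by simp
  next
    case (Suc k)
    let ?X = "v ` {1..2 * k + 1}" and ?a = "v (2 * k + 2)" and ?b = "v (2 * k + 3)"
    let ?K = "delete_verts G ?X"
    have lt: "2 * k + 3 < q" using Suc.prems q by linarith
    have nX: "?a \<notin> ?X" "?b \<notin> ?X" using inj lt by auto
    have ab: "{?a, ?b} \<in> edges C" by (auto simp: v eval_nat_numeral)
    then have abG: "{?a, ?b} \<in> edges G" using cycles_edges[OF C] by blast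
    then have "{?a, ?b} \<subseteq> verts G" using simple_graph_edge[OF sG abG] by auto
    then have abK: "{?a, ?b} \<in> edges ?K" using abG nX by simp
    have ax: "?a \<noteq> x" using inj[of "2 * k + 2" 0] lt v(2) by simp
    have pend: "e = {?a, ?b}" if e: "e \<in> edges ?K" "?a \<in> e" for e
    proof -
      have eG: "e \<in> edges G" "e \<inter> ?X = {}" using e(1) by auto
      have aC: "?a \<in> verts C" by (simp add: v)
      then have "e \<in> edges C" using out[OF eG(1)] e(2) ax by blast
      obtain w where w: "e = {?a, w}"
        by (rule simple_graph_edge_atE[OF sG eG(1) e(2)])
      have "w = v (Suc (2 * k)) \<or> w = ?b"
        using closed_seq_adj[OF cs, of "Suc (2 * k)" w] \<open>e \<in> edges C\<close>
        unfolding w v(1) by (simp add: eval_nat_numeral)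
      moreover have "w \<noteq> v (Suc (2 * k))" using eG(2) w by auto
      ultimately show ?thesis using w by simp
    qed
    have "rank (adj_matrix (delete_verts ?K {?a, ?b}) \<sigma>) + 2 \<le> rank (adj_matrix ?K \<sigma>)"
      by (rule rank_adj_pendant[OF signed_graph_delete_verts[OF G] abK]) (rule pend)
    moreover have "?X \<union> {?a, ?b} = v ` {1..2 * Suc k + 1}"
    proof -
      have "{1..2 * Suc k + 1} = {1..2 * k + 1} \<union> {2 * k + 2, 2 * k + 3}" by auto
      then show ?thesis by (simp only: image_Un image_insert image_empty)
    qed
    ultimately show ?case using Suc by (simp add: delete_delete_verts)
  qed
  from this[of "h - 1"] have
    "rank (adj_matrix (delete_verts G (v ` {1..2 * (h - 1) + 1})) \<sigma>) + 2 * (h - 1) \<le> rank (adj_matrix G \<sigma>)"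
    using q by simp
  moreover have "v ` {1..2 * (h - 1) + 1} = verts C - {x}"
  proof -
    have "{..<q} = insert 0 {1..2 * (h - 1) + 1}" using q by auto
    then have "verts C = insert x (v ` {1..2 * (h - 1) + 1})"
      using closed_seq_range[OF cs] v by (metis image_insert verts_seq_graph)
    moreover have "x \<notin> v ` {1..2 * (h - 1) + 1}"
    proof
      assume "x \<in> v ` {1..2 * (h - 1) + 1}"
      then obtain i where i: "x = v i" "1 \<le> i" "i \<le> 2 * (h - 1) + 1" by auto
      moreover from this have "i < q" "0 < q" using q by linarith+
      ultimately show False using inj[of 0 i] v(2) by simp
    qed
    ultimately show ?thesis by simp
  qed
  ultimately show ?thesis by (simp add: right_diff_distrib')
qed

text \<open>An alternating half of \<open>C\<close> that misses \<open>x\<close> meets no edge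
  leaving \<open>C\<close>, so it can be joined to any independent set of the rest.\<close>

lemma independence_number_delete_cycle:
  fixes G :: "'v::finite graph"
  assumes C: "C \<in> cycles G" and x: "x \<in> verts C"
    and out: "\<And>e. e \<in> edges G \<Longrightarrow> e \<inter> verts C \<noteq> {} \<Longrightarrow> e \<in> edges C \<or> e \<inter> verts C = {x}"
  shows "cycle_length C div 2 + independence_number (delete_verts G (verts C)) \<le> independence_number G"
proof -
  obtain A where A: "A \<subseteq> verts C" "x \<notin> A" "card A = cycle_length C div 2" "indep A (edges C)"
    by (rule cycle_alternating_set[OF C x])
  obtain I where I: "I \<subseteq> verts G - verts C" "indep I (edges (delete_verts G (verts C)))"
    "card I = independence_number (delete_verts G (verts C))"
    using independence_number_obtain[of "delete_verts G (verts C)"] by auto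
  have indI: "indep I (edges G)" using indep_delete_verts[OF I(1)] I(2) by simp
  have "indep (A \<union> I) (edges G)"
    unfolding indep_alt
  proof (intro ballI impI notI)
    fix a b assume ab: "a \<in> A \<union> I" "b \<in> A \<union> I" "a \<noteq> b" "{a, b} \<in> edges G"
    show False
    proof (cases "a \<in> I \<and> b \<in> I")
      case True
      then show ?thesis using indI ab(3,4) by (simp add: indep_def)
    next
      case False
      then obtain m where "m \<in> {a, b}" "m \<in> A" using ab(1,2) by blast
      then have "m \<in> {a, b} \<inter> verts C" "m \<noteq> x" using A(1,2) by blast+
      then have "{a, b} \<inter> verts C \<noteq> {}" "{a, b} \<inter> verts C \<noteq> {x}" by blast+
      then have e: "{a, b} \<in> edges C" using out[OF ab(4)] by blast
      then have "a \<in> A" "b \<in> A" using cycle_edge_subset[OF C e] ab(1,2) I(1) by blast+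
      then show ?thesis using A(4) e ab(3) by (simp add: indep_def)
    qed
  qed
  then have "card (A \<union> I) \<le> independence_number G"
    using A(1) I(1) cycles_verts[OF C] by (intro independence_number_ge) auto
  moreover have "card (A \<union> I) = card A + card I"
    using A(1) I(1) by (intro card_Un_disjoint) auto
  ultimately show ?thesis using A(3) I(3) by simp
qed

text \<open>Every outgoing edge counts at its end on \<open>C\<close>, and a chord would count at
  both ends. In the first case \<open>x\<close> is an arbitrary vertex of \<open>C\<close>, which
  gives both cases the form required for peeling.\<close>

lemma pendant_cycle_cases:
  assumes G: "simple_graph G" "cycles_vertex_disjoint G" and C: "C \<in> cycles G"
    and le: "(\<Sum>x\<in>verts C. outer_degree G x) \<le> 1"
  obtains x where "x \<in> verts C" "\<And>e. e \<in> edges G \<Longrightarrow> e \<inter> verts C \<noteq> {} \<Longrightarrow> e \<in> edges C"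
  | x y where "x \<in> verts C" "y \<in> verts G" "y \<notin> verts C" "{x, y} \<in> edges G"
      "\<And>e. e \<in> edges G \<Longrightarrow> e \<inter> verts C \<noteq> {} \<Longrightarrow> e \<in> edges C \<or> e = {x, y}"
proof -
  have finC: "finite (verts C)" by (rule cycle_finite(1)[OF C])
  have pair: "outer_degree G a + outer_degree G b \<le> 1" if "a \<in> verts C" "b \<in> verts C" "a \<noteq> b" for a b
  proof -
    have "outer_degree G a + outer_degree G b = (\<Sum>x\<in>{a, b}. outer_degree G x)" using that(3) by simp
    also have "\<dots> \<le> (\<Sum>x\<in>verts C. outer_degree G x)" using that(1,2) finC by (intro sum_mono2) auto
    finally show ?thesis using le by simp
  qed
  have pos: "0 < outer_degree G a" if "e \<in> edges G" "e \<notin> edges C" "a \<in> e" "a \<in> verts C" for a e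
    using that outer_degree_zero[OF G(1) _ that(1,3)] cycle_edges_at[OF G(2) C _ that(3,4)] by blast
  show ?thesis
  proof (cases "\<exists>e\<in>edges G. e \<inter> verts C \<noteq> {} \<and> e \<notin> edges C")
    case False
    then show ?thesis using that(1) cycle_verts_nonempty[OF C] by blast
  next
    case True
    then obtain e x where e: "e \<in> edges G" "e \<notin> edges C" "x \<in> e" "x \<in> verts C" by blast
    obtain y where y: "e = {x, y}" "y \<noteq> x" and yG: "y \<in> verts G"
      by (rule simple_graph_edge_atE[OF G(1) e(1,3)])
    have yC: "y \<notin> verts C" using pair[OF e(4), of y] pos[OF e] pos[OF e(1,2), of y] y by fastforce
    have "f = {x, y}" if f: "f \<in> edges G" "f \<inter> verts C \<noteq> {}" "f \<notin> edges C" for f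
    proof -
      obtain a where a: "a \<in> f" "a \<in> verts C" using f(2) by blast
      have "a = x" using pair[OF e(4) a(2)] pos[OF e] pos[OF f(1,3) a] by fastforce
      have "card {g \<in> edges G - cycle_edges G. x \<in> g} \<le> 1"
        using member_le_sum[of x "verts C" "outer_degree G"] e(4) finC le
        by (simp add: outer_degree_def)
      moreover have "e \<in> {g \<in> edges G - cycle_edges G. x \<in> g}" "f \<in> {g \<in> edges G - cycle_edges G. x \<in> g}"
        using e f a \<open>a = x\<close> cycle_edges_at[OF G(2) C] by blast+
      ultimately have "f = e"
        using card_le_Suc0_iff_eq[of "{g \<in> edges G - cycle_edges G. x \<in> g}"] simple_graph_finite(2)[OF G(1)]
        by simp
      then show ?thesis using y by simp
    qed
    then show ?thesis using that(2)[OF e(4) yG yC] e(1) y(1) by blast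
  qed
qed

text \<open>Covers an isolated vertex, \<open>X = {y}\<close>, and a pendant edge,
  \<open>X = {y, z}\<close>, at once. An independent set meets \<open>X\<close> in at most one
  vertex, so adding \<open>y\<close> restores the size; the only possible neighbour of
  \<open>y\<close> lies in \<open>X\<close> and hence neither in \<open>S\<close> nor on a
  cycle.\<close>

lemma spread_extend:
  assumes G: "simple_graph G" and y: "y \<in> verts G - cycle_verts G" "y \<in> X"
    and X: "X \<inter> cycle_verts G = {}"
    and nb: "\<And>e. e \<in> edges G \<Longrightarrow> y \<in> e \<Longrightarrow> e = X"
    and single: "X = {y} \<or> X \<in> edges G"
    and S: "spread (delete_verts G X) S"
  shows "spread G (insert y S)"
proof -
  let ?U = "cycle_verts G"
  have U: "cycle_verts (delete_verts G X) = ?U" "cycle_edges (delete_verts G X) = cycle_edges G"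
    using cycle_verts_delete_noncyclic[OF X] by auto
  have SX: "S \<subseteq> verts G - X - ?U" using S U by (simp add: spread_def)
  have finS: "finite S" "y \<notin> S" using SX y simple_graph_finite(1)[OF G] finite_subset by blast+
  have finV: "finite (verts (delete_verts G ?U))" using simple_graph_finite(1)[OF G] by simp
  obtain I where I: "I \<subseteq> verts G - ?U" "indep I (edges (delete_verts G ?U))"
    "card I = independence_number (delete_verts G ?U)"
    using independence_number_obtain[OF finV] by auto
  have indI: "indep I (edges G)" using indep_delete_verts[OF I(1)] I(2) by simp
  have IX: "card (I \<inter> X) \<le> 1"
    using single
  proof
    assume "X = {y}"
    then show ?thesis using card_mono[of "{y}" "I \<inter> X"] by simp
  next
    assume XE: "X \<in> edges G"
    then obtain z where z: "X = {y, z}" "z \<noteq> y" by (rule simple_graph_edge_atE[OF G _ y(2)])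
    then have "\<not> (y \<in> I \<and> z \<in> I)" using indI XE by (auto simp: indep_def)
    then have "I \<inter> X \<subseteq> {y} \<or> I \<inter> X \<subseteq> {z}" using z(1) by blast
    then show ?thesis using card_mono[of "{y}" "I \<inter> X"] card_mono[of "{z}" "I \<inter> X"] by auto
  qed
  have "card (I - X) \<le> independence_number (delete_verts (delete_verts G X) ?U)"
  proof (rule independence_number_ge)
    show "finite (verts (delete_verts (delete_verts G X) ?U))" using simple_graph_finite(1)[OF G] by simp
    show "I - X \<subseteq> verts (delete_verts (delete_verts G X) ?U)" using I(1) by auto
    show "indep (I - X) (edges (delete_verts (delete_verts G X) ?U))"
      using indI by (auto simp: indep_def)
  qed
  also have "\<dots> \<le> card S" using S U by (simp add: spread_def)
  finally have "card I \<le> card S + 1"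
    using IX card_Int_Diff[of I X] I(1) simple_graph_finite(1)[OF G] finite_subset
    by (metis (no_types, lifting) Diff_subset add.commute add_le_mono subset_trans)
  then have "independence_number (delete_verts G ?U) \<le> card (insert y S)" using I(3) finS by simp
  moreover have "e \<in> cycle_edges G" if e: "e \<in> edges G" "e \<subseteq> insert y S \<union> ?U" for e
  proof (cases "y \<in> e")
    case True
    then have eX: "e = X" using nb e(1) by blast
    obtain z where "e = {y, z}" "z \<noteq> y" by (rule simple_graph_edge_atE[OF G e(1) True])
    then have "z \<in> S \<union> ?U" "z \<in> X" using e(2) eX by auto
    then show ?thesis using SX X by blast
  next
    case False
    have "X \<inter> e = {}" using e(2) False SX X by blast
    moreover have "e \<subseteq> verts G" using G e(1) by (auto simp: simple_graph_def nsets_def)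
    ultimately have "e \<in> edges (delete_verts G X)" using e(1) by auto
    moreover have "e \<subseteq> S \<union> ?U" using e(2) False by blast
    ultimately show ?thesis using S U unfolding spread_def by metis
  qed
  moreover have "insert y S \<subseteq> verts G - ?U" using SX y(1) by blast
  ultimately show ?thesis by (simp add: spread_def)
qed

text \<open>A set found without \<open>Y\<close> avoids the far ends of the edges leaving
  \<open>C\<close>, so it stays apart from \<open>C\<close>. For nonempty \<open>Y\<close> its size
  is measured against a smaller acyclic part, whence the separate assumption
  \<open>card\<close>.\<close>

lemma spread_add_cycle:
  assumes G: "simple_graph G" "cycles_vertex_disjoint G" and C: "C \<in> cycles G"
    and Y: "Y \<inter> cycle_verts G = {}"
    and out: "\<And>e. e \<in> edges G \<Longrightarrow> e \<inter> verts C \<noteq> {} \<Longrightarrow> e \<in> edges C \<or> e \<inter> Y \<noteq> {}"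
    and S: "spread (delete_verts G (verts C \<union> Y)) S"
    and card: "independence_number (delete_verts G (cycle_verts G)) \<le> card S"
  shows "spread G S"
proof -
  let ?H = "delete_verts G (verts C)"
  have H: "delete_verts G (verts C \<union> Y) = delete_verts ?H Y" by (simp add: delete_delete_verts)
  have "Y \<inter> cycle_verts ?H = {}" using Y cycle_verts_delete_cycle(1)[OF G(2) C] by blast
  note UH = cycle_verts_delete_noncyclic[OF this, folded H]
  have U: "cycle_verts (delete_verts G (verts C \<union> Y)) = cycle_verts G - verts C"
    "cycle_edges (delete_verts G (verts C \<union> Y)) \<subseteq> cycle_edges G"
    using UH cycle_verts_delete_cycle[OF G(2) C] by auto
  have CU: "verts C \<subseteq> cycle_verts G" using C by (auto simp: cycle_verts_def)
  have SV: "S \<subseteq> verts G - cycle_verts G" "S \<inter> Y = {}" using S CU U(1) by (auto simp: spread_def)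
  moreover have "e \<in> cycle_edges G" if e: "e \<in> edges G" "e \<subseteq> S \<union> cycle_verts G" for e
  proof -
    have eY: "e \<inter> Y = {}" using e(2) SV(2) Y by blast
    show ?thesis
    proof (cases "e \<inter> verts C = {}")
      case True
      have "e \<subseteq> verts G" using G(1) e(1) by (auto simp: simple_graph_def nsets_def)
      then have "e \<in> edges (delete_verts G (verts C \<union> Y))" using e(1) eY True by auto
      moreover have "e \<subseteq> S \<union> (cycle_verts G - verts C)" using e(2) True by blast
      ultimately show ?thesis using S U unfolding spread_def by blast
    next
      case False
      then show ?thesis using out[OF e(1)] eY C by (auto simp: cycle_edges_def)
    qed
  qed
  ultimately show ?thesis using card by (simp add: spread_def)
qed

text \<open>If \<open>C\<close> has a single outgoing edge \<open>{x, y}\<close>, deleting a neighbour of \<open>x\<close> on \<open>C\<close> leaves a pendant path, and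
  stripping it shows that the excess still vanishes after deleting \<open>C\<close>, with or without \<open>y\<close>.
  Comparing independence numbers, a suitable set for the smaller graph, which avoids \<open>y\<close>,
  is also large enough for \<open>G\<close>.\<close>

lemma excess_zero_spread_pendant_cycle:
  fixes G :: "'v::finite graph"
  assumes G: "signed_graph G \<sigma>" and z0: "excess G \<sigma> = 0" and C: "C \<in> cycles G"
    and le: "(\<Sum>x\<in>verts C. outer_degree G x) \<le> 1"
    and IH: "\<And>X x. x \<in> X \<Longrightarrow> x \<in> verts G \<Longrightarrow> excess (delete_verts G X) \<sigma> = 0
      \<Longrightarrow> \<exists>S. spread (delete_verts G X) S"
  shows "\<exists>S. spread G S"
proof -
  note sG = signed_graph_imp_simple[OF G]
  have disj: "cycles_vertex_disjoint G" by (rule excess_zero_cycles_disjoint[OF G z0])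
  let ?H = "delete_verts G (verts C)"
  let ?U = "cycle_verts G"
  have CU: "verts C \<subseteq> ?U" using C by (auto simp: cycle_verts_def)
  obtain h where h: "cycle_length C = 2 * h"
    using excess_zero_cycle_condition[OF G z0 C] by blast
  have cC: "card (verts C) = 2 * h" using h card_cycle_verts[OF C] by (simp add: cycle_length_def)
  have h2: "2 \<le> h" using cycle_card_ge[OF C] cC by linarith
  have nH: "card (verts G) = card (verts G - verts C) + 2 * h"
    using card_Diff_subset[of "verts C" "verts G"] cycles_verts[OF C] card_mono[of "verts G" "verts C"] cC
    by simp
  obtain c0 where c0: "c0 \<in> verts C" using cycle_verts_nonempty[OF C] by blast
  then have c0G: "c0 \<in> verts G" using cycles_verts[OF C] by blast
  have cycH: "cyclomatic_number ?H + 1 \<le> cyclomatic_number G"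
  proof -
    have "?H = delete_verts (delete_verts G {c0}) (verts C)"
      using c0 by (simp add: delete_delete_verts insert_absorb)
    then have "cyclomatic_number ?H \<le> cyclomatic_number (delete_verts G {c0})"
      using cyclomatic_delete_le[OF simple_graph_delete_verts[OF sG]] by simp
    then show ?thesis using cyclomatic_delete_cycle_vert[OF sG C c0] by simp
  qed
  have sH: "signed_graph ?H \<sigma>" by (rule signed_graph_delete_verts[OF G])
  \<comment> \<open>Deleting \<open>C\<close> loses \<open>2h\<close> vertices, at least
    \<open>2h - 2\<close> of the rank, \<open>h\<close> of the independence number and one of
    \<open>c\<close>; \<open>4h - (2h - 2) - 2h - 2 = 0\<close>, so the excess does not
    grow.\<close>
  have H_zero: "excess ?H \<sigma> = 0 \<and> h + independence_number ?H \<le> independence_number G"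
    if x: "x \<in> verts C"
      and out: "\<And>e. e \<in> edges G \<Longrightarrow> e \<inter> verts C \<noteq> {} \<Longrightarrow> e \<in> edges C \<or> e \<inter> verts C = {x}" for x
  proof -
    let ?K = "delete_verts G (verts C - {x})"
    have "rank (adj_matrix ?K \<sigma>) + (2 * h - 2) \<le> rank (adj_matrix G \<sigma>)"
      by (rule rank_adj_peel_cycle[OF G C x h]) (rule out)
    moreover have "delete_verts ?K {x} = ?H" using x by (simp add: delete_delete_verts insert_absorb)
    then have "rank (adj_matrix ?H \<sigma>) \<le> rank (adj_matrix ?K \<sigma>)"
      using rank_adj_delete_le[OF simple_graph_delete_verts[OF sG], of "verts C - {x}" "{x}" \<sigma>] by simp
    moreover have a: "h + independence_number ?H \<le> independence_number G"
      using independence_number_delete_cycle[OF C x out] h by simp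
    ultimately have "excess ?H \<sigma> \<le> excess G \<sigma>"
      using nH cycH h2 unfolding excess_def by simp
    then show ?thesis using excess_nonneg[OF sH] z0 a by simp
  qed
  have GU: "delete_verts ?H (cycle_verts ?H) = delete_verts G ?U"
    using CU cycle_verts_delete_cycle(1)[OF disj C] by (simp add: delete_delete_verts Un_absorb1)
  from pendant_cycle_cases[OF sG disj C le] show ?thesis
  proof cases
    case (1 x)
    have "excess ?H \<sigma> = 0" using H_zero[OF 1(1)] 1(2) by blast
    then obtain S where S: "spread ?H S" using IH[OF c0 c0G] by blast
    have "spread G S"
      by (rule spread_add_cycle[OF sG disj C, of "{}"])
        (use S 1(2) GU in \<open>auto simp: spread_def simp del: edges_delete_verts\<close>)
    then show ?thesis by blast
  next
    case (2 x y)
    let ?K = "delete_verts G (verts C - {x})"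
    let ?M = "delete_verts G (verts C \<union> {y})"
    have out: "e \<in> edges C \<or> e \<inter> verts C = {x}" if "e \<in> edges G" "e \<inter> verts C \<noteq> {}" for e
      using 2(5)[OF that] 2(1,3) by blast
    have H0: "excess ?H \<sigma> = 0" "h + independence_number ?H \<le> independence_number G"
      using H_zero[OF 2(1) out] by auto
    have "verts C - {x} \<union> {x, y} = verts C \<union> {y}" using 2(1) by auto
    then have KM: "delete_verts ?K {x, y} = ?M" by (simp only: delete_delete_verts)
    have HM: "delete_verts ?H {y} = ?M" by (simp add: delete_delete_verts)
    \<comment> \<open>Peeling leaves only \<open>x\<close> of the cycle, now pendant at
      \<open>y\<close>, and the pair \<open>{x, y}\<close> is worth another 2.\<close>
    have rk: "rank (adj_matrix ?M \<sigma>) + 2 * h \<le> rank (adj_matrix G \<sigma>)"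
    proof -
      have "{x, y} \<subseteq> verts G" using simple_graph_edge[OF sG 2(4)] by blast
      then have xyK: "{x, y} \<in> edges ?K" using 2(3,4) by auto
      have "rank (adj_matrix (delete_verts ?K {x, y}) \<sigma>) + 2 \<le> rank (adj_matrix ?K \<sigma>)"
      proof (rule rank_adj_pendant[OF signed_graph_delete_verts[OF G] xyK])
        fix e assume e: "e \<in> edges ?K" "x \<in> e"
        have eG: "e \<in> edges G" "e \<inter> (verts C - {x}) = {}" using e(1) by auto
        have "e \<notin> edges C"
        proof
          assume "e \<in> edges C"
          moreover obtain w where "e = {x, w}" "w \<noteq> x" by (rule simple_graph_edge_atE[OF sG eG(1) e(2)])
          ultimately show False using eG(2) cycle_edge_subset[OF C] by blast
        qed
        then show "e = {x, y}" using 2(5)[OF eG(1)] e(2) 2(1) by blast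
      qed
      moreover have "rank (adj_matrix ?K \<sigma>) + (2 * h - 2) \<le> rank (adj_matrix G \<sigma>)"
        by (rule rank_adj_peel_cycle[OF G C 2(1) h]) (rule out)
      ultimately show ?thesis using KM h2 by simp
    qed
    have aM: "independence_number ?M \<le> independence_number ?H"
      using independence_number_delete_le[of ?H "{y}"] HM by simp
    have cM: "cyclomatic_number ?M \<le> cyclomatic_number ?H"
      using cyclomatic_delete_le[OF signed_graph_imp_simple[OF sH], of "{y}"] HM by simp
    have nM: "card (verts G) = card (verts ?M) + 2 * h + 1"
    proof -
      have "verts ?M = (verts G - verts C) - {y}" by auto
      then have "card (verts G - verts C) = Suc (card (verts ?M))"
        using 2(2,3) by (metis DiffI card_Suc_Diff1 finite)
      then show ?thesis using nH by simp
    qed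
    have "0 \<le> excess ?M \<sigma>" by (rule excess_nonneg[OF signed_graph_delete_verts[OF G]])
    \<comment> \<open>From \<open>G\<close> to \<open>?M\<close>, \<open>2h + 1\<close> vertices are
      lost, at least \<open>2h\<close> of the rank, \<open>h\<close> of the independence number and
      one of \<open>c\<close>. Since \<open>4h + 2 - 2h - 2h - 2 = 0\<close> and the excess cannot
      become negative, every estimate is an equality.\<close>
    then have M0: "excess ?M \<sigma> = 0" and cMH: "cyclomatic_number ?M = cyclomatic_number ?H"
      and aMH: "independence_number ?M = independence_number ?H"
      using rk aM cM nM H0(2) cycH z0 unfolding excess_def by linarith+
    have yU: "y \<notin> ?U"
    proof
      assume "y \<in> ?U"
      then obtain D where D: "D \<in> cycles ?H" "y \<in> verts D"
        using 2(3) cycle_verts_delete_cycle(1)[OF disj C] by (auto simp: cycle_verts_def)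
      then show False
        using cyclomatic_delete_cycle_vert[OF signed_graph_imp_simple[OF sH] D] HM cMH by simp
    qed
    obtain S' where S': "spread ?M S'" using IH[of c0 "verts C \<union> {y}"] c0 c0G M0 by blast
    obtain T where T: "spread ?H T" using IH[OF c0 c0G H0(1)] by blast
    have dH: "cycles_vertex_disjoint ?H" by (rule excess_zero_cycles_disjoint[OF sH H0(1)])
    have sM: "signed_graph ?M \<sigma>" by (rule signed_graph_delete_verts[OF G])
    have dM: "cycles_vertex_disjoint ?M" by (rule excess_zero_cycles_disjoint[OF sM M0])
    have "{y} \<inter> cycle_verts ?H = {}" using yU cycle_verts_delete_cycle(1)[OF disj C] by simp
    then have UM: "cycle_verts ?M = cycle_verts ?H" using cycle_verts_delete_noncyclic(1) HM by metis
    \<comment> \<open>\<open>T\<close> serves for its size. Through the equal independence numbers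
      of \<open>?H\<close> and \<open>?M\<close> and their common cycle vertices,
      \<open>card T \<le> card S'\<close>, and \<open>card T\<close> bounds the independence number
      of the acyclic part of \<open>G\<close>.\<close>
    have "2 * card T + card (cycle_verts ?H) \<le> 2 * independence_number ?H"
      using excess_zero_cycle_condition[OF sH H0(1)]
      by (intro spread_independence_number[OF signed_graph_imp_simple[OF sH] dH T]) fastforce
    moreover have "2 * independence_number ?M
        \<le> 2 * independence_number (delete_verts ?M (cycle_verts ?M)) + card (cycle_verts ?M)"
      by (rule independence_number_le_noncyclic[OF signed_graph_imp_simple[OF sM] dM])
    moreover have "independence_number (delete_verts ?M (cycle_verts ?M)) \<le> card S'"
      using S' by (simp add: spread_def)
    moreover have "independence_number (delete_verts G ?U) \<le> card T"
      using T GU by (simp add: spread_def)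
    ultimately have "independence_number (delete_verts G ?U) \<le> card S'" using aMH UM by simp
    then have "spread G S'"
      using yU 2(5) by (intro spread_add_cycle[OF sG disj C _ _ S']) auto
    then show ?thesis by blast
  qed
qed

lemma excess_zero_spread:
  assumes "signed_graph G \<sigma>" "excess G \<sigma> = 0"
  shows "\<exists>S. spread G S"
  using assms
proof (induction "card (verts G)" arbitrary: G rule: less_induct)
  case (less G)
  note G = less.prems(1) and z0 = less.prems(2)
  note sG = signed_graph_imp_simple[OF G]
  have disj: "cycles_vertex_disjoint G" by (rule excess_zero_cycles_disjoint[OF G z0])
  have IH: "\<exists>S. spread (delete_verts G X) S"
    if "x \<in> X" "x \<in> verts G" "excess (delete_verts G X) \<sigma> = 0" for x X
  proof -
    have "card (verts (delete_verts G X)) < card (verts G)"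
      using that(1,2) by (auto intro!: psubset_card_mono)
    then show ?thesis using less.hyps signed_graph_delete_verts[OF G] that(3) by blast
  qed
  show ?case
  proof (cases "verts G = {}")
    case True
    then have "edges G = {}" using sG by (auto simp: simple_graph_def nsets_def)
    moreover have "independence_number (delete_verts G (cycle_verts G)) \<le> 0"
      using True independence_number_obtain[of "delete_verts G (cycle_verts G)"] by fastforce
    ultimately have "spread G {}" using True by (simp add: spread_def)
    then show ?thesis by blast
  next
    case False
    from low_degree_or_pendant_cycle[OF sG disj False] show ?thesis
    proof
      assume "\<exists>x\<in>verts G - cycle_verts G. vdegree G x \<le> 1"
      then obtain x where x: "x \<in> verts G - cycle_verts G" "vdegree G x \<le> 1" by blast
      then have xG: "x \<in> verts G" by simp
      from degree_cases[OF sG x(2)] show ?thesis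
      proof cases
        case 1
        then have "excess (delete_verts G {x}) \<sigma> = 0"
          by (rule excess_zero_delete_isolated[OF G z0 xG])
        then obtain S where S: "spread (delete_verts G {x}) S" using IH[of x "{x}"] xG by blast
        have "spread G (insert x S)"
          using x(1) 1 by (intro spread_extend[OF sG _ _ _ _ _ S]) auto
        then show ?thesis by blast
      next
        case (2 z)
        have *: "excess (delete_verts G {x, z}) \<sigma> = 0"
          by (rule excess_zero_delete_pendant(1)[OF G z0 xG 2(4)]) (rule 2(5))
        have zU: "z \<notin> cycle_verts G"
          by (rule excess_zero_delete_pendant(2)[OF G z0 xG 2(4)]) (rule 2(5))
        obtain S where S: "spread (delete_verts G {x, z}) S" using IH[of x "{x, z}"] xG * by blast
        have "spread G (insert x S)"
          by (rule spread_extend[OF sG x(1) _ _ 2(5) _ S]) (use x(1) zU 2(4) in auto)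
        then show ?thesis by blast
      qed
    next
      assume "\<exists>C\<in>cycles G. (\<Sum>x\<in>verts C. outer_degree G x) \<le> 1"
      then obtain C where C: "C \<in> cycles G" "(\<Sum>x\<in>verts C. outer_degree G x) \<le> 1" by blast
      show ?thesis by (rule excess_zero_spread_pendant_cycle[OF G z0 C]) (rule IH)
    qed
  qed
qed

section \<open>Sufficiency of the conditions\<close>

lemma adj_matrix_cycle_sum:
  assumes G: "simple_graph G" "cycles_vertex_disjoint G" and E: "edges H = cycle_edges G"
  shows "adj_matrix H \<sigma> = (\<Sum>C\<in>cycles G. adj_matrix C \<sigma>)"
proof (simp only: vec_eq_iff sum_component, intro allI)
  fix i j
  show "adj_matrix H \<sigma> $ i $ j = (\<Sum>C\<in>cycles G. adj_matrix C \<sigma> $ i $ j)"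
  proof (cases "{i, j} \<in> cycle_edges G")
    case True
    then obtain C where C: "C \<in> cycles G" "{i, j} \<in> edges C" by (auto simp: cycle_edges_def)
    \<comment> \<open>Disjoint cycles share no edge, so only the summand of \<open>C\<close> can
      contribute to this entry.\<close>
    have "{i, j} \<notin> edges D" if D: "D \<in> cycles G - {C}" for D
      using cycles_disjointD[OF G(2) C(1), of D i] cycle_edge_subset[OF C] cycle_edge_subset[of D G "{i, j}"] D
      by auto
    then have "(\<Sum>D\<in>cycles G - {C}. adj_matrix D \<sigma> $ i $ j) = 0"
      by (intro sum.neutral) (auto simp: adj_matrix_def)
    then have "(\<Sum>C\<in>cycles G. adj_matrix C \<sigma> $ i $ j) = adj_matrix C \<sigma> $ i $ j"
      using sum.remove[OF simple_graph_finite(3)[OF G(1)] C(1), of "\<lambda>C. adj_matrix C \<sigma> $ i $ j"] by simp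
    then show ?thesis using True C(2) E by (simp add: adj_matrix_def)
  next
    case False
    then have "{i, j} \<notin> edges C" if "C \<in> cycles G" for C using that by (auto simp: cycle_edges_def)
    then have "(\<Sum>C\<in>cycles G. adj_matrix C \<sigma> $ i $ j) = 0"
      by (intro sum.neutral) (auto simp: adj_matrix_def)
    then show ?thesis using False E by (simp add: adj_matrix_def)
  qed
qed

lemma spread_excess_zero:
  assumes G: "signed_graph G \<sigma>" and disj: "cycles_vertex_disjoint G"
    and cond: "\<And>C. C \<in> cycles G \<Longrightarrow> \<exists>h. cycle_length C = 2 * h \<and> cycle_sign \<sigma> C = (-1) ^ h"
    and S: "spread G S"
  shows "excess G \<sigma> = 0"
proof -
  note sG = signed_graph_imp_simple[OF G]
  let ?U = "cycle_verts G"
  define W where "W = verts G - ?U - S"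
  let ?H = "delete_verts G W"
  have SV: "S \<subseteq> verts G - ?U" using S by (simp add: spread_def)
  have VW: "verts G - W = S \<union> ?U" using SV cycle_verts_subset[of G] by (auto simp: W_def)
  have "edges ?H = cycle_edges G"
  proof
    show "edges ?H \<subseteq> cycle_edges G" using S VW unfolding spread_def by auto
    show "cycle_edges G \<subseteq> edges ?H"
    proof
      fix e assume e: "e \<in> cycle_edges G"
      then have "e \<in> edges G" using cycle_edges_subset by blast
      moreover have "e \<subseteq> ?U" using e cycle_edge_subset unfolding cycle_edges_def cycle_verts_def by blast
      ultimately show "e \<in> edges ?H" using VW by auto
    qed
  qed
  then have "adj_matrix ?H \<sigma> = (\<Sum>C\<in>cycles G. adj_matrix C \<sigma>)"
    by (rule adj_matrix_cycle_sum[OF sG disj])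
  then have "rank (adj_matrix ?H \<sigma>) \<le> (\<Sum>C\<in>cycles G. rank (adj_matrix C \<sigma>))"
    using rank_sum_le[OF simple_graph_finite(3)[OF sG]] by simp
  moreover have "(\<Sum>C\<in>cycles G. rank (adj_matrix C \<sigma>)) + 2 * card (cycles G) \<le> card ?U"
  proof -
    have "(\<Sum>C\<in>cycles G. rank (adj_matrix C \<sigma>)) + 2 * card (cycles G)
        = (\<Sum>C\<in>cycles G. rank (adj_matrix C \<sigma>) + 2)"
      by (simp only: sum.distrib sum_constant mult.commute of_nat_id)
    also have "\<dots> \<le> (\<Sum>C\<in>cycles G. card (verts C))"
    proof (rule sum_mono)
      fix C assume C: "C \<in> cycles G"
      then obtain h where "cycle_length C = 2 * h" "cycle_sign \<sigma> C = (-1) ^ h" using cond by blast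
      then show "rank (adj_matrix C \<sigma>) + 2 \<le> card (verts C)"
        using rank_cycle_le[OF C G] card_cycle_verts[OF C] by (simp add: cycle_length_def)
    qed
    finally show ?thesis using card_cycle_verts_eq(1)[OF sG disj] by simp
  qed
  moreover have "rank (adj_matrix G \<sigma>) \<le> rank (adj_matrix ?H \<sigma>) + 2 * card W"
    by (rule rank_adj_delete_ge[OF sG])
  moreover have "2 * independence_number G \<le> 2 * card S + card ?U"
    using independence_number_le_noncyclic[OF sG disj] S unfolding spread_def by linarith
  moreover have "card (verts G) = card W + card S + card ?U"
  proof -
    have "verts G = W \<union> (S \<union> ?U)" using VW by (auto simp: W_def)
    then have "card (verts G) = card W + card (S \<union> ?U)"
      by (metis VW card_Un_disjoint Diff_disjoint finite)
    moreover have "card (S \<union> ?U) = card S + card ?U" using SV by (intro card_Un_disjoint) auto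
    ultimately show ?thesis by simp
  qed
  ultimately have "excess G \<sigma> \<le> 0"
    using cyclomatic_eq_card_cycles[OF sG disj] unfolding excess_def by linarith
  then show ?thesis using excess_nonneg[OF G] by simp
qed

section \<open>The contracted graph\<close>

lemma verts_contract_cycles:
  "verts (contract_cycles G) = cyclic_vertices G \<union> (\<lambda>v. {v}) ` (verts G - cycle_verts G)"
  by (auto simp: contract_cycles_def cycle_verts_def cyclic_vertices_def)

lemma contract_cycles_edge_iff:
  "{X, Y} \<in> edges (contract_cycles G) \<longleftrightarrow> X \<in> verts (contract_cycles G)
     \<and> Y \<in> verts (contract_cycles G) \<and> X \<noteq> Y \<and> (\<exists>x\<in>X. \<exists>y\<in>Y. {x, y} \<in> edges G)"
proof -
  let ?B = "verts (contract_cycles G)"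
  have E: "edges (contract_cycles G)
    = {{X, Y} | X Y. X \<in> ?B \<and> Y \<in> ?B \<and> X \<noteq> Y \<and> (\<exists>x\<in>X. \<exists>y\<in>Y. {x, y} \<in> edges G)}"
    by (simp add: contract_cycles_def Let_def)
  have sym: "(\<exists>x\<in>X. \<exists>y\<in>Y. {x, y} \<in> edges G) \<longleftrightarrow> (\<exists>x\<in>Y. \<exists>y\<in>X. {x, y} \<in> edges G)" for X Y
    by (metis insert_commute)
  show ?thesis
  proof
    assume "{X, Y} \<in> edges (contract_cycles G)"
    then obtain X' Y' where "{X, Y} = {X', Y'}" "X' \<in> ?B" "Y' \<in> ?B" "X' \<noteq> Y'"
      "\<exists>x\<in>X'. \<exists>y\<in>Y'. {x, y} \<in> edges G" unfolding E by blast
    then show "X \<in> ?B \<and> Y \<in> ?B \<and> X \<noteq> Y \<and> (\<exists>x\<in>X. \<exists>y\<in>Y. {x, y} \<in> edges G)"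
      using sym[of X' Y'] by (auto simp only: doubleton_eq_iff)
  qed (unfold E, blast)
qed

text \<open>A cycle has at least three vertices, so a cyclic block is never confused with the block
  of a single vertex.\<close>

lemma cyclic_vertices_disjoint_singletons:
  "cyclic_vertices G \<inter> (\<lambda>v. {v}) ` A = {}"
proof -
  have "card X \<noteq> 1" if "X \<in> cyclic_vertices G" for X
    using that cycle_card_ge[of _ G] by (fastforce simp: cyclic_vertices_def)
  then show ?thesis by fastforce
qed

lemma Union_cyclic_vertices: "\<Union> (cyclic_vertices G) = cycle_verts G"
  by (simp add: cyclic_vertices_def cycle_verts_def)

lemma noncyclic_part_verts:
  "verts (noncyclic_part G) = (\<lambda>v. {v}) ` (verts G - cycle_verts G)"
  using cyclic_vertices_disjoint_singletons[of G]
  by (auto simp: noncyclic_part_def verts_contract_cycles)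

lemma noncyclic_part_indep_iff:
  assumes G: "simple_graph G" and S: "S \<subseteq> verts G - cycle_verts G"
  shows "indep ((\<lambda>v. {v}) ` S) (edges (noncyclic_part G)) \<longleftrightarrow> indep S (edges G)"
proof -
  have "{{a}, {b}} \<in> edges (noncyclic_part G) \<longleftrightarrow> {a, b} \<in> edges G" if ab: "a \<in> S" "b \<in> S" "a \<noteq> b" for a b
  proof -
    have "{a} \<in> verts (noncyclic_part G)" "{b} \<in> verts (noncyclic_part G)"
      using S ab noncyclic_part_verts[of G] by auto
    then have "{{a}, {b}} \<in> edges (noncyclic_part G) \<longleftrightarrow> {{a}, {b}} \<in> edges (contract_cycles G)"
      by (simp add: noncyclic_part_def)
    then show ?thesis
      using ab(3) S ab by (auto simp: contract_cycles_edge_iff verts_contract_cycles)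
  qed
  then show ?thesis by (auto simp: indep_def)
qed

text \<open>The map from \<open>v\<close> to \<open>{v}\<close> is an isomorphism from
  \<open>G\<close> without its cycle vertices onto the noncyclic part.\<close>

lemma independence_number_noncyclic_part:
  assumes G: "simple_graph G"
  shows "independence_number (noncyclic_part G) = independence_number (delete_verts G (cycle_verts G))"
proof (rule antisym)
  let ?D = "delete_verts G (cycle_verts G)"
  have fin: "finite (verts ?D)" "finite (verts (noncyclic_part G))"
    using simple_graph_finite(1)[OF G] by (simp_all add: noncyclic_part_verts)
  have inj: "inj_on (\<lambda>v. {v}) S" for S :: "'a set" by simp
  obtain R where R: "R \<subseteq> verts (noncyclic_part G)" "indep R (edges (noncyclic_part G))"
    "card R = independence_number (noncyclic_part G)"
    by (rule independence_number_obtain[OF fin(2)])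
  then obtain S where S: "S \<subseteq> verts G - cycle_verts G" "R = (\<lambda>v. {v}) ` S"
    unfolding noncyclic_part_verts by (auto simp: subset_image_iff)
  then have "indep S (edges G)" using noncyclic_part_indep_iff[OF G S(1)] R(2) by simp
  then have "card S \<le> independence_number ?D"
    using S(1) indep_delete_verts[OF S(1)] by (intro independence_number_ge[OF fin(1)]) simp_all
  then show "independence_number (noncyclic_part G) \<le> independence_number ?D"
    using R(3) S(2) by (simp add: card_image)
  obtain I where I: "I \<subseteq> verts G - cycle_verts G" "indep I (edges ?D)" "card I = independence_number ?D"
    using independence_number_obtain[OF fin(1)] by auto
  then have "indep ((\<lambda>v. {v}) ` I) (edges (noncyclic_part G))"
    using noncyclic_part_indep_iff[OF G I(1)] indep_delete_verts[OF I(1)] by simp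
  then have "card ((\<lambda>v. {v}) ` I) \<le> independence_number (noncyclic_part G)"
    using I(1) by (intro independence_number_ge[OF fin(2)]) (auto simp: noncyclic_part_verts)
  then show "independence_number ?D \<le> independence_number (noncyclic_part G)"
    using I(3) by (simp add: card_image)
qed

lemma card_cyclic_vertices:
  assumes "simple_graph G" "cycles_vertex_disjoint G"
  shows "int (card (cyclic_vertices G)) = cyclomatic_number G"
proof -
  have "inj_on verts (cycles G)"
  proof (rule inj_onI)
    fix C D assume CD: "C \<in> cycles G" "D \<in> cycles G" "verts C = verts D"
    obtain x where "x \<in> verts C" using cycle_verts_nonempty[OF CD(1)] by blast
    then show "C = D" using cycles_disjointD[OF assms(2) CD(1,2)] CD(3) by simp
  qed
  then show ?thesis using cyclomatic_eq_card_cycles[OF assms] by (simp add: cyclic_vertices_def card_image)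
qed

text \<open>Summed up, the left side of (iii) never exceeds the right side, so that (iii) is the
  extreme case in which both parts of a maximum independent set are as large as possible.\<close>

lemma independent_contract_split:
  assumes G: "simple_graph G" and R: "R \<subseteq> verts (contract_cycles G)" "indep R (edges (contract_cycles G))"
  shows "card R = card (R \<inter> cyclic_vertices G) + card (R - cyclic_vertices G)"
    and "card (R \<inter> cyclic_vertices G) \<le> card (cyclic_vertices G)"
    and "card (R - cyclic_vertices G) \<le> independence_number (noncyclic_part G)"
proof -
  have fin: "finite (cyclic_vertices G)" "finite (verts (contract_cycles G))"
    using simple_graph_finite[OF G] by (simp_all add: cyclic_vertices_def verts_contract_cycles)
  have "finite R" using R(1) fin(2) finite_subset by blast
  then show "card R = card (R \<inter> cyclic_vertices G) + card (R - cyclic_vertices G)"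
    by (rule card_Int_Diff)
  show "card (R \<inter> cyclic_vertices G) \<le> card (cyclic_vertices G)"
    using fin(1) by (intro card_mono) auto
  have sub: "R - cyclic_vertices G \<subseteq> verts (contract_cycles G) - cyclic_vertices G" using R(1) by blast
  then have "indep (R - cyclic_vertices G) (edges (noncyclic_part G))"
    unfolding noncyclic_part_def indep_delete_verts[OF sub] using R(2) by (auto simp: indep_def)
  then show "card (R - cyclic_vertices G) \<le> independence_number (noncyclic_part G)"
    using sub fin(2) by (intro independence_number_ge) (auto simp: noncyclic_part_def)
qed

text \<open>In the extreme case a maximum independent set contains all cyclic vertices, and its
  singletons form the set \<open>S\<close>. Conversely, the cyclic vertices and the singletons of a
  spread set reach the upper bound.\<close>

lemma contract_cycles_spread_iff:
  assumes G: "simple_graph G" "cycles_vertex_disjoint G"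
  shows "int (independence_number (contract_cycles G))
      = int (independence_number (noncyclic_part G)) + cyclomatic_number G
    \<longleftrightarrow> (\<exists>S. spread G S)"
proof -
  let ?T = "contract_cycles G" and ?U = "cycle_verts G" and ?c = "card (cyclic_vertices G)"
  have finT: "finite (verts ?T)" and finc: "finite (cyclic_vertices G)"
    using simple_graph_finite[OF G(1)] by (simp_all add: cyclic_vertices_def verts_contract_cycles)
  obtain R where R: "R \<subseteq> verts ?T" "indep R (edges ?T)" "card R = independence_number ?T"
    by (rule independence_number_obtain[OF finT])
  note split = independent_contract_split[OF G(1) R(1,2)]
  have eq: "int (independence_number ?T) = int (independence_number (noncyclic_part G)) + cyclomatic_number G
    \<longleftrightarrow> independence_number ?T = independence_number (noncyclic_part G) + ?c"
    using card_cyclic_vertices[OF G] by linarith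
  show ?thesis
    unfolding eq
  proof
    assume "independence_number ?T = independence_number (noncyclic_part G) + ?c"
    then have R1: "card (R \<inter> cyclic_vertices G) = ?c"
      and R2: "card (R - cyclic_vertices G) = independence_number (noncyclic_part G)"
      using split R(3) by linarith+
    have cycR: "cyclic_vertices G \<subseteq> R"
      using card_subset_eq[OF finc _ R1] by blast
    have "R - cyclic_vertices G \<subseteq> (\<lambda>v. {v}) ` (verts G - ?U)"
      using R(1) unfolding verts_contract_cycles by blast
    then obtain S where S: "S \<subseteq> verts G - ?U" "R - cyclic_vertices G = (\<lambda>v. {v}) ` S"
      by (auto simp: subset_image_iff)
    have "card S = card (R - cyclic_vertices G)" using S(2) by (simp add: card_image)
    then have "independence_number (delete_verts G ?U) \<le> card S"
      using R2 independence_number_noncyclic_part[OF G(1)] by simp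
    moreover have "e \<in> cycle_edges G" if e: "e \<in> edges G" "e \<subseteq> S \<union> ?U" for e
    proof -
      have block: "\<exists>X\<in>R. a \<in> X \<and> (X = {a} \<or> X \<in> cyclic_vertices G)" if "a \<in> S \<union> ?U" for a
      proof (cases "a \<in> S")
        case True
        then show ?thesis using S(2) by blast
      next
        case False
        then show ?thesis using that cycR unfolding Union_cyclic_vertices[symmetric] by blast
      qed
      obtain a b where ab: "e = {a, b}" "a \<noteq> b" by (rule simple_graph_edgeE[OF G(1) e(1)])
      obtain X where X: "X \<in> R" "a \<in> X" "X = {a} \<or> X \<in> cyclic_vertices G" using block[of a] e(2) ab by blast
      obtain Y where Y: "Y \<in> R" "b \<in> Y" using block[of b] e(2) ab by blast
      \<comment> \<open>An edge between different blocks would survive in the contracted graph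
        within the independent set \<open>R\<close>. So both ends lie in one block, which must be a
        cycle, and cycles have no chords.\<close>
      have "X = Y"
      proof (rule ccontr)
        assume ne: "X \<noteq> Y"
        then have "{X, Y} \<in> edges ?T"
          unfolding contract_cycles_edge_iff using R(1) X Y e(1) ab(1) by blast
        then show False using R(2) X(1) Y(1) ne by (simp add: indep_def)
      qed
      then have "X \<in> cyclic_vertices G" using X(3) Y(2) ab(2) by auto
      then obtain C where C: "C \<in> cycles G" "X = verts C" by (auto simp: cyclic_vertices_def)
      then have "{a, b} \<in> edges C"
        using X(2) Y(2) \<open>X = Y\<close> e(1) ab(1) by (intro cycle_chordless[OF G C(1)]) auto
      then show ?thesis using C(1) ab(1) by (auto simp: cycle_edges_def)
    qed
    ultimately have "spread G S" using S(1) by (simp add: spread_def)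
    then show "\<exists>S. spread G S" by blast
  next
    assume "\<exists>S. spread G S"
    then obtain S where S: "S \<subseteq> verts G - ?U" "independence_number (delete_verts G ?U) \<le> card S"
      "\<And>e. e \<in> edges G \<Longrightarrow> e \<subseteq> S \<union> ?U \<Longrightarrow> e \<in> cycle_edges G" by (auto simp: spread_def)
    define Q where "Q = cyclic_vertices G \<union> (\<lambda>v. {v}) ` S"
    have QSU: "X \<subseteq> S \<union> ?U" if "X \<in> Q" for X
      using that Union_cyclic_vertices[of G] by (auto simp: Q_def)
    have block: "X = verts C" if X: "X \<in> Q" "a \<in> X" and C: "C \<in> cycles G" "a \<in> verts C" for X a C
    proof -
      have "a \<in> ?U" using C by (auto simp: cycle_verts_def)
      then obtain D where D: "D \<in> cycles G" "X = verts D"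
        using X S(1) by (auto simp: Q_def cyclic_vertices_def)
      then show ?thesis using cycles_disjointD[OF G(2) D(1) C(1)] X(2) C(2) by blast
    qed
    have "indep Q (edges ?T)"
      unfolding indep_alt
    proof (intro ballI impI notI)
      fix X Y assume XY: "X \<in> Q" "Y \<in> Q" "X \<noteq> Y" "{X, Y} \<in> edges ?T"
      then obtain x y where xy: "x \<in> X" "y \<in> Y" "{x, y} \<in> edges G"
        unfolding contract_cycles_edge_iff by blast
      then have "{x, y} \<in> cycle_edges G" using QSU[OF XY(1)] QSU[OF XY(2)] by (intro S(3)) auto
      then obtain C where C: "C \<in> cycles G" "{x, y} \<in> edges C" by (auto simp: cycle_edges_def)
      then have "x \<in> verts C" "y \<in> verts C" using cycle_edge_subset by blast+
      then show False using block[OF XY(1) xy(1) C(1)] block[OF XY(2) xy(2) C(1)] XY(3) by simp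
    qed
    moreover have "Q \<subseteq> verts ?T" using S(1) by (auto simp: Q_def verts_contract_cycles)
    ultimately have "card Q \<le> independence_number ?T" by (intro independence_number_ge[OF finT])
    moreover have "card Q = ?c + card S"
    proof -
      have "finite S" using S(1) simple_graph_finite(1)[OF G(1)] finite_subset by blast
      then show ?thesis unfolding Q_def
        using finc cyclic_vertices_disjoint_singletons[of G S] by (subst card_Un_disjoint) (simp_all add: card_image)
    qed
    ultimately show "independence_number ?T = independence_number (noncyclic_part G) + ?c"
      using split R(3) S(2) independence_number_noncyclic_part[OF G(1)] by linarith
  qed
qed

text \<open>Both admissible cases of (ii) say that the length is even and the sign is
  \<open>-1\<close> to the power of half the length, the form that linear algebra produces.\<close>

lemma cycle_condition_iff:
  fixes q :: nat and s :: real
  shows "(\<exists>h. q = 2 * h \<and> s = (-1) ^ h) \<longleftrightarrow> q mod 4 = 0 \<and> s = 1 \<or> q mod 4 = 2 \<and> s = -1"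
proof
  assume "\<exists>h. q = 2 * h \<and> s = (-1) ^ h"
  then obtain h where h: "q = 2 * h" "s = (-1) ^ h" by blast
  show "q mod 4 = 0 \<and> s = 1 \<or> q mod 4 = 2 \<and> s = -1"
  proof (cases "even h")
    case True
    then obtain k where "h = 2 * k" by blast
    then show ?thesis using h by simp
  next
    case False
    then obtain k where "h = 2 * k + 1" by (rule oddE)
    then have "q = 4 * k + 2" using h by simp
    then have "q mod 4 = 2" by presburger
    then show ?thesis using h(2) False by simp
  qed
next
  assume "q mod 4 = 0 \<and> s = 1 \<or> q mod 4 = 2 \<and> s = -1"
  then show "\<exists>h. q = 2 * h \<and> s = (-1) ^ h"
  proof
    assume a: "q mod 4 = 0 \<and> s = 1"
    then have "q = 2 * (2 * (q div 4))" using div_mult_mod_eq[of q 4] by linarith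
    then show ?thesis using a by (intro exI[of _ "2 * (q div 4)"]) simp
  next
    assume a: "q mod 4 = 2 \<and> s = -1"
    then have "q = 2 * (2 * (q div 4) + 1)" using div_mult_mod_eq[of q 4] by simp
    then show ?thesis using a by (intro exI[of _ "2 * (q div 4) + 1"]) simp
  qed
qed

theorem theorem1p2:
  fixes G :: "'v::finite graph" and \<sigma> :: "'v set \<Rightarrow> real" and n :: nat
  assumes "signed_graph G \<sigma>" and "verts G = UNIV" and "card (verts G) = n"
  shows "int (rank (adj_matrix G \<sigma>)) + 2 * int (independence_number G)
           = 2 * int n - 2 * cyclomatic_number G
     \<longleftrightarrow>
       cycles_vertex_disjoint G
       \<and> (\<forall>C\<in>cycles G.
             cycle_length C mod 4 = 0 \<and> cycle_sign \<sigma> C = 1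
           \<or> cycle_length C mod 4 = 2 \<and> cycle_sign \<sigma> C = -1)
       \<and> int (independence_number (contract_cycles G))
           = int (independence_number (noncyclic_part G)) + cyclomatic_number G"
proof -
  note sG = signed_graph_imp_simple[OF assms(1)]
  have "int (rank (adj_matrix G \<sigma>)) + 2 * int (independence_number G)
      = 2 * int n - 2 * cyclomatic_number G \<longleftrightarrow> excess G \<sigma> = 0"
    using assms(3) by (auto simp: excess_def)
  moreover have "excess G \<sigma> = 0 \<longleftrightarrow> cycles_vertex_disjoint G
       \<and> (\<forall>C\<in>cycles G. \<exists>h. cycle_length C = 2 * h \<and> cycle_sign \<sigma> C = (-1) ^ h)
       \<and> (\<exists>S. spread G S)"
    using excess_zero_cycles_disjoint[OF assms(1)] excess_zero_cycle_condition[OF assms(1)]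
      excess_zero_spread[OF assms(1)] spread_excess_zero[OF assms(1)] by blast
  ultimately show ?thesis
    using contract_cycles_spread_iff[OF sG] unfolding cycle_condition_iff by blast
qed

end
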